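(* For $n\ge 1$ let $\mathcal{T}_n$ be the number of trees (connected components) in a uniformly random unlabeled forest on $n$ vertices. Let $\mathcal{P}$ be a discrete compound Poisson random variable with compounding measure $\xi$ on the integers $k\ge 1$ given by $\xi_k = t(\alpha^k)/k$. Then, as $n\to\infty$, $\mathcal{T}_n-1$ converges to $\mathcal{P}$ with all of its moments; that is, $\mathcal{T}_n-1\to\mathcal{P}$ in distribution and $\mathbb{E}[(\mathcal{T}_n-1)^m]\to\mathbb{E}[\mathcal{P}^m]$ for every integer $m\ge1$.
   Context: An unlabeled tree (resp. forest) on $n$ vertices is an isomorphism class of trees (resp. acyclic simple graphs) with $n$ vertices; trees are unrooted. $t_n$ denotes the number of unlabeled trees on $n$ vertices, and $t(x)=\sum_{n=1}^\infty t_n x^n$ (the sum starts at $n=1$). A uniformly random unlabeled forest on $n$ vertices is uniform over the isomorphism classes of forests with $n$ vertices. Otter's constants $\alpha,\beta\in(0,\infty)$ are the constants for which $\lim_{n\to\infty}\alpha^n n^{5/2}t_n=\beta$ (this limit relation is Otter's theorem); $\alpha\approx0.338$, $\beta\approx 0.534$. In particular $\alpha$ is the radius of convergence of $t(x)$. A random variable $X$ is compound Poisson distributed with compounding measure $\xi$ if $\mathbb{E}(e^{-\phi X})=\exp\left(-\int_0^\infty(1-e^{-\phi x})\,\xi(dx)\right)$ for all $\phi>0$. In the discrete case with $\xi$ supported on the integers $k\ge 1$, the integral is $\sum_{k\ge1}(1-e^{-\phi k})\xi_k$. *)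

theory Defs
  imports "HOL-Probability.Probability"
begin

text \<open>
  A simple graph is given by a vertex set V and a set E of two-element subsets of V.
  The directed notions of trees and forests in the AFP entry Graph_Theory are unsuitable here:
  in a symmetric digraph every edge already gives a directed cycle of length two.
\<close>

definition simple_graph :: "'a set \<Rightarrow> 'a set set \<Rightarrow> bool" where
  "simple_graph V E \<longleftrightarrow> (\<forall>e\<in>E. e \<subseteq> V \<and> card e = 2)"

definition adj :: "'a set set \<Rightarrow> ('a \<times> 'a) set" where
  "adj E = {(u, v). {u, v} \<in> E}"

definition graph_cycle :: "'a set set \<Rightarrow> 'a list \<Rightarrow> bool" where
  "graph_cycle E vs \<longleftrightarrow> length vs \<ge> 3 \<and> distinct vs \<and>
     (\<forall>i<length vs. {vs ! i, vs ! (Suc i mod length vs)} \<in> E)"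

definition forest :: "'a set \<Rightarrow> 'a set set \<Rightarrow> bool" where
  "forest V E \<longleftrightarrow> simple_graph V E \<and> (\<nexists>vs. graph_cycle E vs)"

definition connected_graph :: "'a set \<Rightarrow> 'a set set \<Rightarrow> bool" where
  "connected_graph V E \<longleftrightarrow> simple_graph V E \<and> V \<noteq> {} \<and> (\<forall>u\<in>V. \<forall>v\<in>V. (u, v) \<in> (adj E)\<^sup>*)"

definition tree :: "'a set \<Rightarrow> 'a set set \<Rightarrow> bool" where
  "tree V E \<longleftrightarrow> forest V E \<and> connected_graph V E"

definition graph_components :: "'a set \<Rightarrow> 'a set set \<Rightarrow> 'a set set" where
  "graph_components V E = V // ((adj E)\<^sup>* \<inter> V \<times> V)"

definition graph_iso :: "'a set \<Rightarrow> ('a set set \<times> 'a set set) set" where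
  "graph_iso V = {(E, F). simple_graph V E \<and> simple_graph V F \<and>
     (\<exists>\<pi>. bij_betw \<pi> V V \<and> F = (\<lambda>e. \<pi> ` e) ` E)}"

text \<open>
  Every graph with n vertices is isomorphic to one with vertex set \<open>{..<n}\<close>, so the isomorphism
  classes are represented by the classes of graphs on this vertex set.
\<close>

definition unlabeled_trees :: "nat \<Rightarrow> nat set set set set" where
  "unlabeled_trees n = {E. tree {..<n} E} // graph_iso {..<n}"

definition unlabeled_forests :: "nat \<Rightarrow> nat set set set set" where
  "unlabeled_forests n = {E. forest {..<n} E} // graph_iso {..<n}"

text \<open>
  The common number of components of all representatives of the class C;
  see the lemma \<open>num_trees_eq\<close> below.
\<close>

definition num_trees :: "nat \<Rightarrow> nat set set set \<Rightarrow> nat" where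
  "num_trees n C = the_elem ((\<lambda>E. card (graph_components {..<n} E)) ` C)"

definition random_forest :: "nat \<Rightarrow> nat set set set pmf" where
  "random_forest n = pmf_of_set (unlabeled_forests n)"

definition tree_count :: "nat \<Rightarrow> nat" where
  "tree_count n = card (unlabeled_trees n)"

definition tree_gf :: "real \<Rightarrow> real" where
  "tree_gf x = (\<Sum>n. real (tree_count (Suc n)) * x ^ Suc n)"

text \<open>
  The integrability conjunct only excludes the case in which the right-hand side would be
  \<open>exp (-\<infinity>) = 0\<close> mathematically, whereas the Bochner integral is \<open>0\<close> by convention.
\<close>

definition compound_poisson :: "'b measure \<Rightarrow> ('b \<Rightarrow> real) \<Rightarrow> real measure \<Rightarrow> bool" where
  "compound_poisson M X \<xi> \<longleftrightarrow> (\<forall>\<phi>>0.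
     set_integrable \<xi> {0<..} (\<lambda>x. 1 - exp (- \<phi> * x)) \<and>
     (LINT \<omega>|M. exp (- \<phi> * X \<omega>)) = exp (- (LINT x:{0<..}|\<xi>. 1 - exp (- \<phi> * x))))"

text \<open>The measure with mass \<open>w k\<close> at every integer \<open>k \<ge> 1\<close>, for nonnegative weights; \<open>w 0\<close> is ignored.\<close>

definition discrete_measure :: "(nat \<Rightarrow> real) \<Rightarrow> real measure" where
  "discrete_measure w = distr (density (count_space {1..}) (\<lambda>k. ennreal (w k))) borel real"

lemma equiv_graph_iso: "equiv {E. simple_graph V E} (graph_iso V)"
proof (rule equivI)
  show "graph_iso V \<subseteq> {E. simple_graph V E} \<times> {E. simple_graph V E}"
    by (auto simp: graph_iso_def)
  show "refl_on {E. simple_graph V E} (graph_iso V)"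
    by (auto simp: refl_on_def graph_iso_def intro!: exI[of _ id])
  show "sym (graph_iso V)"
  proof (rule symI)
    fix E F assume "(E, F) \<in> graph_iso V"
    then obtain \<pi> where *: "simple_graph V E" "simple_graph V F" "bij_betw \<pi> V V"
      "F = (\<lambda>e. \<pi> ` e) ` E" by (auto simp: graph_iso_def)
    have "inv_into V \<pi> ` \<pi> ` e = e" if "e \<in> E" for e
      using that * by (intro inv_into_image_cancel) (auto simp: bij_betw_def simple_graph_def)
    hence "E = (\<lambda>e. inv_into V \<pi> ` e) ` F"
      unfolding *(4) image_image by force
    thus "(F, E) \<in> graph_iso V"
      using * bij_betw_inv_into[OF *(3)] by (auto simp: graph_iso_def)
  qed
  show "trans (graph_iso V)"
  proof (rule transI)
    fix E F G assume "(E, F) \<in> graph_iso V" "(F, G) \<in> graph_iso V"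
    then obtain \<pi> \<rho> where *: "simple_graph V E" "simple_graph V G" "bij_betw \<pi> V V"
      "bij_betw \<rho> V V" "F = (\<lambda>e. \<pi> ` e) ` E" "G = (\<lambda>e. \<rho> ` e) ` F"
      by (auto simp: graph_iso_def)
    have "G = (\<lambda>e. (\<rho> \<circ> \<pi>) ` e) ` E"
      unfolding * image_image by (simp add: image_comp)
    thus "(E, G) \<in> graph_iso V"
      using * bij_betw_trans[OF *(3,4)] unfolding graph_iso_def by blast
  qed
qed

lemma finite_unlabeled_forests: "finite (unlabeled_forests n)"
proof -
  have "{E. forest {..<n} E} \<subseteq> Pow (Pow {..<n})"
    by (auto simp: forest_def simple_graph_def)
  hence "finite {E. forest {..<n} E}"
    by (rule finite_subset) auto
  thus ?thesis
    unfolding unlabeled_forests_def quotient_def by auto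
qed

lemma unlabeled_forests_nonempty: "unlabeled_forests n \<noteq> {}"
proof -
  have "\<not> graph_cycle {} vs" for vs :: "nat list"
    by (auto simp: graph_cycle_def intro!: exI[of _ 0])
  hence "forest {..<n} {}"
    by (auto simp: forest_def simple_graph_def)
  thus ?thesis
    by (auto simp: unlabeled_forests_def quotient_def)
qed

lemma rtrancl_adj_image:
  assumes "(u, v) \<in> (adj E)\<^sup>*"
  shows "(\<pi> u, \<pi> v) \<in> (adj ((\<lambda>e. \<pi> ` e) ` E))\<^sup>*"
  using assms
proof (induction rule: rtrancl_induct)
  case (step y z)
  have "{\<pi> y, \<pi> z} = \<pi> ` {y, z}" by simp
  hence "(\<pi> y, \<pi> z) \<in> adj ((\<lambda>e. \<pi> ` e) ` E)"
    using step.hyps unfolding adj_def by blast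
  with step.IH show ?case by simp
qed simp

lemma card_graph_components_le:
  assumes "finite V" "(E, F) \<in> graph_iso V"
  shows "card (graph_components V F) \<le> card (graph_components V E)"
proof -
  obtain \<pi> where *: "simple_graph V E" "bij_betw \<pi> V V" "F = (\<lambda>e. \<pi> ` e) ` E"
    using assms(2) by (auto simp: graph_iso_def)
  let ?R = "\<lambda>E. (adj E)\<^sup>* \<inter> V \<times> V"
  have sym: "sym ((adj E)\<^sup>*)" for E :: "'a set set"
    by (intro sym_rtrancl symI) (auto simp: adj_def insert_commute)
  have eq: "equiv V (?R E)" for E :: "'a set set"
    by (intro equivI refl_onI symI transI)
       (auto dest: symD[OF sym] intro: rtrancl_trans)
  define f where "f = (\<lambda>A. ?R F `` (\<pi> ` A))"
  have f: "f (?R E `` {u}) = ?R F `` {\<pi> u}" if "u \<in> V" for u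
  proof -
    have pu: "\<pi> u \<in> V" using that *(2) by (auto simp: bij_betw_def)
    have "?R F `` {\<pi> v} = ?R F `` {\<pi> u}" if "v \<in> ?R E `` {u}" for v
    proof (rule equiv_class_eq[OF eq])
      have "(u, v) \<in> (adj E)\<^sup>*" "v \<in> V" using that by auto
      hence "(\<pi> v, \<pi> u) \<in> (adj F)\<^sup>*" "\<pi> v \<in> V"
        using rtrancl_adj_image[of u v E \<pi>] *(2) symD[OF sym] by (auto simp: *(3) bij_betw_def)
      thus "(\<pi> v, \<pi> u) \<in> ?R F" using pu by auto
    qed
    moreover have "u \<in> ?R E `` {u}" using that by auto
    moreover have "f (?R E `` {u}) = (\<Union>v\<in>?R E `` {u}. ?R F `` {\<pi> v})"
      unfolding f_def by blast
    ultimately show ?thesis by blast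
  qed
  have "graph_components V F = f ` graph_components V E"
  proof -
    have "graph_components V F = (\<lambda>u. ?R F `` {u}) ` \<pi> ` V"
      using *(2) by (auto simp: graph_components_def quotient_def bij_betw_def)
    also have "\<dots> = (\<lambda>u. f (?R E `` {u})) ` V"
      unfolding image_image using f by (intro image_cong) auto
    also have "\<dots> = f ` graph_components V E"
      unfolding graph_components_def quotient_def by blast
    finally show ?thesis .
  qed
  moreover have "finite (graph_components V E)"
    using assms(1) by (auto simp: graph_components_def quotient_def)
  ultimately show ?thesis by (simp add: card_image_le)
qed

lemma num_trees_eq:
  assumes "C \<in> unlabeled_forests n" "E \<in> C"
  shows "num_trees n C = card (graph_components {..<n} E)"
proof -
  have symm: "(F, E) \<in> graph_iso {..<n}" if "(E, F) \<in> graph_iso {..<n}" for E F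
    using equiv_graph_iso that unfolding equiv_def by (blast dest: symD)
  have "(E, F) \<in> graph_iso {..<n}" if "F \<in> C" for F
  proof -
    obtain G where G: "C = graph_iso {..<n} `` {G}"
      using assms(1) by (auto simp: unlabeled_forests_def elim: quotientE)
    show ?thesis
      using symm[of G E] that assms(2) equiv_graph_iso[of "{..<n}"]
      unfolding G equiv_def by (blast dest: transD)
  qed
  note iso = this symm[OF this]
  hence "card (graph_components {..<n} F) = card (graph_components {..<n} E)" if "F \<in> C" for F
    using that by (intro antisym card_graph_components_le iso) auto
  hence "(\<lambda>E. card (graph_components {..<n} E)) ` C = {card (graph_components {..<n} E)}"
    using assms(2) by blast
  thus ?thesis by (simp add: num_trees_def)
qed

lemma
  fixes f :: "real \<Rightarrow> real"
  assumes w: "\<And>k. w k \<ge> 0" and f: "f \<in> borel_measurable borel"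
  shows set_integrable_discrete_measure:
      "set_integrable (discrete_measure w) {0<..} f \<longleftrightarrow>
         summable (\<lambda>k. \<bar>w (Suc k) * f (real (Suc k))\<bar>)"
    and LINT_discrete_measure:
      "summable (\<lambda>k. \<bar>w (Suc k) * f (real (Suc k))\<bar>) \<Longrightarrow>
         (LINT x:{0<..}|discrete_measure w. f x) = (\<Sum>k. w (Suc k) * f (real (Suc k)))"
proof -
  let ?g = "\<lambda>k. w k * (indicat_real {0<..} (real k) * f (real k))"
  have meas[measurable]: "real \<in> measurable (density (count_space {1..}) (\<lambda>k. ennreal (w k))) borel"
    by simp
  have bij: "bij_betw Suc UNIV {1..}"
    by (rule bij_betwI[where g = "\<lambda>k. k - 1"]) auto
  have int: "set_integrable (discrete_measure w) {0<..} f \<longleftrightarrow> integrable (count_space {1..}) ?g"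
    unfolding set_integrable_def discrete_measure_def using f w
    by (subst integrable_distr_eq, simp_all, subst integrable_density) auto
  have "integrable (count_space {1..}) ?g \<longleftrightarrow> integrable (count_space UNIV) (\<lambda>k. ?g (Suc k))"
    using integrable_bij_count_space[OF bij, of ?g] by simp
  also have "\<dots> \<longleftrightarrow> summable (\<lambda>k. \<bar>w (Suc k) * f (real (Suc k))\<bar>)"
    by (simp add: integrable_count_space_nat_iff del: of_nat_Suc)
  finally show 1: "set_integrable (discrete_measure w) {0<..} f \<longleftrightarrow>
      summable (\<lambda>k. \<bar>w (Suc k) * f (real (Suc k))\<bar>)"
    using int by simp
  assume sm: "summable (\<lambda>k. \<bar>w (Suc k) * f (real (Suc k))\<bar>)"
  have "(LINT x:{0<..}|discrete_measure w. f x) = (LINT k|count_space {1..}. ?g k)"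
    unfolding set_lebesgue_integral_def discrete_measure_def using f w
    by (subst integral_distr, simp_all, subst integral_density) auto
  also have "\<dots> = (LINT k|count_space UNIV. ?g (Suc k))"
    using integral_bij_count_space[OF bij, of ?g] by simp
  also have "\<dots> = (\<Sum>k. ?g (Suc k))"
    by (intro integral_count_space_nat) (use sm in \<open>simp add: integrable_count_space_nat_iff del: of_nat_Suc\<close>)
  finally show "(LINT x:{0<..}|discrete_measure w. f x) = (\<Sum>k. w (Suc k) * f (real (Suc k)))"
    by (simp del: of_nat_Suc)
qed

end

theory Submission
  imports Defs "HOL-Real_Asymp.Real_Asymp"
begin

text \<open>
  A forest is a multiset of trees. Therefore the polynomials
  \<open>F\<^sub>n(z) = \<Sum>\<^sub>C z ^ num_trees n C\<close>, where \<open>C\<close> runs over the unlabeled forests with \<open>n\<close> vertices, satisfy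
  \<open>\<Sum>n. F\<^sub>n(z) * x ^ n = exp (\<Sum>k\<ge>1. z ^ k / k * t (x ^ k))\<close>
  (lemmas \<open>unlabeled_forests_bij_weighted_multisets\<close> and \<open>multiset_gf_rec\<close>).

  After the substitution of \<open>\<alpha> * x\<close> for \<open>x\<close>, the \<open>m\<close>-th coefficient of the exponent is asymptotically
  \<open>\<beta> * z * m powr (-5/2)\<close>: the summand \<open>k = 1\<close> contributes Otter's asymptotics, and the summands with
  \<open>k \<ge> 2\<close> are exponentially small since \<open>\<alpha> < 1\<close>. This holds for positive \<open>z\<close> up to some point
  beyond \<open>1\<close> (lemma \<open>power_sum_coeff_asymptotics\<close>). Such a regularly varying sequence is dominated by
  one large summand, even after the exponential function has been applied (lemma \<open>regular_variation\<close>):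
  a large random forest consists of one giant tree and a stochastically bounded rest. Hence
  \<open>\<alpha> ^ n * F\<^sub>n(z) * n powr (5/2)\<close> tends to \<open>\<beta> * z * exp (\<Sum>k\<ge>1. z ^ k / k * t (\<alpha> ^ k))\<close>, and the
  probability generating function \<open>F\<^sub>n(z) / F\<^sub>n(1)\<close> of the number of trees tends to
  \<open>z * exp (\<Sum>k\<ge>1. (z ^ k - 1) * t (\<alpha> ^ k) / k)\<close>. The factor \<open>z\<close> stands for the giant tree, and the other
  factor at \<open>z = exp (- \<phi>)\<close> is the Laplace transform of the compound Poisson variable.

  Convergence of Laplace transforms gives convergence in distribution (lemma \<open>weak_conv_m_if_Laplace\<close>).
  Since the generating functions also converge at a point beyond \<open>1\<close>, all moments are bounded
  uniformly in \<open>n\<close>, and therefore they converge as well (lemma \<open>moments_tendsto_if_weak_conv_m\<close>).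
\<close>

section \<open>Coefficients of exponentials of power series\<close>

text \<open>
  The recurrence is \<open>x C'(x) = x G'(x) C(x)\<close> read off coefficientwise, so it says
  \<open>C = exp G\<close> for the power series \<open>G\<close> and \<open>C\<close> with coefficients \<open>g\<close> and \<open>c\<close>. It is the form
  in which exponentials of generating functions come out of counting arguments.
\<close>

locale exp_recurrence =
  fixes g c :: "nat \<Rightarrow> real"
  assumes g_0: "g 0 = 0" and g_nonneg: "\<And>m. g m \<ge> 0" and c_0: "c 0 = 1"
    and rec: "\<And>n. real n * c n = (\<Sum>i<n. real (n - i) * g (n - i) * c i)"
begin

lemma c_nonneg: "c n \<ge> 0"
proof (induction n rule: less_induct)
  case (less n)
  show ?case
  proof (cases "n = 0")
    case False
    have "real n * c n \<ge> 0"
      unfolding rec using less.IH g_nonneg by (intro sum_nonneg mult_nonneg_nonneg) auto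
    with False show ?thesis by (simp add: zero_le_mult_iff)
  qed (simp add: c_0)
qed

text \<open>
  Truncating both series at degree \<open>N\<close> to polynomials \<open>S\<close> and \<open>G\<close> only loses nonnegative products, so \<open>S' \<le> G' S\<close> on the positive axis and \<open>S exp (- G)\<close> decreases from its value \<open>1\<close> at \<open>0\<close>.
\<close>

lemma sum_c_le: "(\<Sum>i\<le>N. c i) \<le> exp (\<Sum>m\<le>N. g m)"
proof -
  define S where "S = (\<lambda>x. \<Sum>i\<le>N. c i * x ^ i)"
  define G where "G = (\<lambda>x. \<Sum>m\<le>N. g m * x ^ m)"
  define S' where "S' = (\<lambda>x. \<Sum>i\<le>N. c i * (real i * x ^ (i - 1)))"
  define G' where "G' = (\<lambda>x. \<Sum>m\<le>N. g m * (real m * x ^ (m - 1)))"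
  have dS: "(S has_real_derivative S' x) (at x)" for x
    unfolding S_def S'_def by (auto intro!: derivative_eq_intros sum.cong)
  have dG: "(G has_real_derivative G' x) (at x)" for x
    unfolding G_def G'_def by (auto intro!: derivative_eq_intros sum.cong)
  have *: "S' x \<le> G' x * S x" if "x > 0" for x
  proof -
    have x_pow: "x * (a * (real i * x ^ (i - 1))) = real i * a * x ^ i" for a i
      by (cases i) auto
    have "x * S' x = (\<Sum>n\<le>N. real n * c n * x ^ n)"
      unfolding S'_def sum_distrib_left
      by (intro sum.cong refl x_pow)
    also have "\<dots> = (\<Sum>n\<le>N. \<Sum>i<n. (real (n - i) * g (n - i) * x ^ (n - i)) * (c i * x ^ i))"
      unfolding rec sum_distrib_right
      by (intro sum.cong refl) (simp add: power_add[symmetric])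
    also have "\<dots> = (\<Sum>(n,i)\<in>(SIGMA n:{..N}. {..<n}). (real (n - i) * g (n - i) * x ^ (n - i)) * (c i * x ^ i))"
      by (rule sum.Sigma) auto
    also have "\<dots> = (\<Sum>(m,i)\<in>(\<lambda>(n,i). (n - i, i)) ` (SIGMA n:{..N}. {..<n}). (real m * g m * x ^ m) * (c i * x ^ i))"
      by (rule sum.reindex_cong[symmetric, of "\<lambda>(n,i). (n - i, i)"])
         (auto simp: inj_on_def simp del: of_nat_diff)
    also have "\<dots> \<le> (\<Sum>(m,i)\<in>{..N}\<times>{..N}. (real m * g m * x ^ m) * (c i * x ^ i))"
      using that g_nonneg c_nonneg by (intro sum_mono2) auto
    also have "\<dots> = (\<Sum>m\<le>N. real m * g m * x ^ m) * S x"
      by (simp add: S_def sum_product sum.cartesian_product)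
    also have "(\<Sum>m\<le>N. real m * g m * x ^ m) = x * G' x"
      unfolding G'_def sum_distrib_left
      by (intro sum.cong refl x_pow[symmetric])
    finally show ?thesis using that by (simp add: mult.assoc)
  qed
  have "S 1 * exp (- G 1) \<le> S 0 * exp (- G 0)"
  proof (rule DERIV_nonpos_imp_decreasing_open[where f = "\<lambda>x. S x * exp (- G x)"])
    fix x :: real assume "0 < x" "x < 1"
    have "((\<lambda>x. S x * exp (- G x)) has_real_derivative (S' x - G' x * S x) * exp (- G x)) (at x)"
      by (auto intro!: derivative_eq_intros dS dG simp: algebra_simps)
    thus "\<exists>y. ((\<lambda>x. S x * exp (- G x)) has_real_derivative y) (at x) \<and> y \<le> 0"
      using *[OF \<open>0 < x\<close>] by (intro exI conjI) (auto simp: mult_le_0_iff)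
  qed (auto simp: S_def G_def intro!: continuous_intros)
  moreover have "S 0 = 1" "G 0 = 0"
    using c_0 g_0 by (auto simp: S_def G_def power_0_left if_distrib[of "(*) _"] cong: if_cong)
  ultimately show ?thesis
    by (simp add: S_def G_def exp_minus field_simps)
qed

text \<open>
  The preceding bound makes \<open>c\<close> summable; hence the differential equation can be solved on \<open>[0, 1)\<close>,
  where it gives \<open>C = exp G\<close>, and monotone passage to the limit at \<open>1\<close> gives the missing lower bound.
\<close>

lemma c_sums:
  assumes "summable g"
  shows "c sums exp (\<Sum>m. g m)"
proof -
  have bound: "(\<Sum>i<N. c i) \<le> exp (\<Sum>m. g m)" for N
  proof -
    have "(\<Sum>i<N. c i) \<le> (\<Sum>i\<le>N. c i)"
      using c_nonneg by (intro sum_mono2) auto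
    also have "\<dots> \<le> exp (\<Sum>m\<le>N. g m)" by (rule sum_c_le)
    also have "\<dots> \<le> exp (\<Sum>m. g m)"
      using assms g_nonneg by (simp add: sum_le_suminf)
    finally show ?thesis .
  qed
  have c: "summable c"
    using c_nonneg bound by (intro summableI_nonneg_bounded) auto
  define f where "f = (\<lambda>x. \<Sum>n. c n * x ^ n)"
  define h where "h = (\<lambda>x. \<Sum>n. g n * x ^ n)"
  have deriv: "((\<lambda>x. f x * exp (- h x)) has_real_derivative 0) (at x)" if "0 \<le> x" "x < 1" for x
  proof -
    have nx: "norm x < 1" using that by auto
    have df: "(f has_real_derivative (\<Sum>n. diffs c n * x ^ n)) (at x)"
      unfolding f_def using c nx by (intro termdiffs_strong[where K = 1]) auto
    have dh: "(h has_real_derivative (\<Sum>n. diffs g n * x ^ n)) (at x)"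
      unfolding h_def using assms nx by (intro termdiffs_strong[where K = 1]) auto
    have sums: "summable (\<lambda>n. norm (diffs g n * x ^ n))" "summable (\<lambda>n. norm (c n * x ^ n))"
    proof -
      have "summable (\<lambda>n. norm (g n * y ^ n))" if "norm y < 1" for y
        using that assms powser_insidea[of g 1 y] by auto
      hence "summable (\<lambda>n. g n * y ^ n)" if "norm y < 1" for y
        using that by (metis summable_norm_cancel)
      hence "summable (\<lambda>n. diffs g n * x ^ n)"
        using termdiff_converges[OF nx] by blast
      thus "summable (\<lambda>n. norm (diffs g n * x ^ n))"
        using g_nonneg that by (simp add: diffs_def)
      show "summable (\<lambda>n. norm (c n * x ^ n))"
        using nx c powser_insidea[of c 1 x] by auto
    qed
    have "diffs c n * x ^ n = (\<Sum>i\<le>n. diffs g i * x ^ i * (c (n - i) * x ^ (n - i)))" for n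
    proof -
      have "diffs c n = (\<Sum>i\<le>n. diffs g (n - i) * c i)"
        using rec[of "Suc n"] by (simp add: diffs_def lessThan_Suc_atMost Suc_diff_le)
      also have "\<dots> = (\<Sum>i\<le>n. diffs g i * c (n - i))"
        by (rule sum.reindex_bij_witness[of _ "\<lambda>i. n - i" "\<lambda>i. n - i"]) auto
      finally have "diffs c n * x ^ n = (\<Sum>i\<le>n. diffs g i * c (n - i) * x ^ n)"
        by (simp only: sum_distrib_right)
      also have "\<dots> = (\<Sum>i\<le>n. diffs g i * x ^ i * (c (n - i) * x ^ (n - i)))"
      proof (intro sum.cong refl)
        fix i assume "i \<in> {..n}"
        hence "x ^ n = x ^ i * x ^ (n - i)" by (simp flip: power_add)
        thus "diffs g i * c (n - i) * x ^ n = diffs g i * x ^ i * (c (n - i) * x ^ (n - i))"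
          by simp
      qed
      finally show ?thesis .
    qed
    hence "(\<Sum>n. diffs c n * x ^ n) = (\<Sum>n. diffs g n * x ^ n) * f x"
      using Cauchy_product[OF sums] by (simp add: f_def)
    thus ?thesis
      by (auto intro!: derivative_eq_intros df dh simp: algebra_simps)
  qed
  have eq: "f x = exp (h x)" if "0 \<le> x" "x < 1" for x
  proof -
    have "f x * exp (- h x) = f 0 * exp (- h 0)"
    proof (cases "x = 0")
      case False
      show ?thesis
      proof (rule DERIV_isconst2[of 0 x])
        show "continuous_on {0..x} (\<lambda>x. f x * exp (- h x))"
          using that by (intro continuous_at_imp_continuous_on ballI DERIV_isCont[OF deriv]) auto
      qed (use that False deriv in auto)
    qed auto
    moreover have "f 0 = 1" "h 0 = 0"
      using c_0 g_0 by (auto simp: f_def h_def)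
    ultimately show ?thesis by (simp add: exp_minus field_simps)
  qed
  have lower: "exp (\<Sum>m<N. g m) \<le> (\<Sum>i. c i)" for N
  proof (rule tendsto_upperbound)
    show "((\<lambda>x. exp (\<Sum>m<N. g m * x ^ m)) \<longlongrightarrow> exp (\<Sum>m<N. g m)) (at_left (1::real))"
      by (auto intro!: tendsto_eq_intros)
    show "eventually (\<lambda>x. exp (\<Sum>m<N. g m * x ^ m) \<le> (\<Sum>i. c i)) (at_left (1::real))"
      using eventually_at_left_real[of 0 "1::real"]
    proof (rule eventually_mono)
      fix x :: real assume x: "x \<in> {0<..<1}"
      have g: "summable (\<lambda>n. g n * x ^ n)"
        using x assms powser_inside[of g 1 x] by auto
      have c': "summable (\<lambda>n. c n * x ^ n)"
        using x c powser_inside[of c 1 x] by auto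
      have "exp (\<Sum>m<N. g m * x ^ m) \<le> exp (h x)"
        unfolding h_def exp_le_cancel_iff using x g_nonneg by (intro sum_le_suminf g) auto
      also have "\<dots> = f x" using x by (simp add: eq)
      also have "\<dots> \<le> (\<Sum>i. c i)"
        unfolding f_def using x c_nonneg
        by (intro suminf_le c c' mult_right_le_one_le power_le_one) auto
      finally show "exp (\<Sum>m<N. g m * x ^ m) \<le> (\<Sum>i. c i)" .
    qed auto
  qed auto
  have "exp (\<Sum>m. g m) \<le> (\<Sum>i. c i)"
    by (rule LIMSEQ_le_const2[OF tendsto_exp[OF summable_LIMSEQ[OF assms]]]) (use lower in auto)
  moreover have "(\<Sum>i. c i) \<le> exp (\<Sum>m. g m)"
    using c bound by (intro suminf_le_const) auto
  ultimately show ?thesis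
    using c by (simp add: sums_iff)
qed

text \<open>
  The principle of one large summand: \<open>c n\<close> is dominated by those contributions in which a single
  factor \<open>g m\<close> carries almost the whole index \<open>n\<close>, while the remaining index \<open>n - m\<close> stays bounded
  and is distributed according to \<open>c\<close>, whose sum is \<open>exp (\<Sum>m. g m)\<close>. The condition \<open>p > 2\<close> makes
  \<open>m * g m\<close> summable, which is what keeps all other contributions small.
\<close>

lemma regular_variation:
  assumes p: "p > 2" and lim: "(\<lambda>m. g m * real m powr p) \<longlonglongrightarrow> \<gamma>"
  shows "summable g" and "(\<lambda>n. c n * real n powr p) \<longlonglongrightarrow> \<gamma> * exp (\<Sum>m. g m)"
proof -
  have powr_Suc: "x powr (p - 1) * x = x powr p" "x powr p * x powr (1 - p) = x" if "x > 0" for x :: real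
    using that powr_add[of x "p - 1" 1] powr_add[of x p "1 - p"] by auto
  define w where "w = (\<lambda>m. real m * g m)"
  have w_nonneg: "w m \<ge> 0" for m using g_nonneg by (simp add: w_def)
  obtain D where "\<forall>m. norm (g m * real m powr p) \<le> D"
    using convergent_imp_Bseq[OF convergentI[OF lim]] by (auto simp: Bseq_def)
  hence D: "g m * real m powr p \<le> D" for m by (metis abs_le_D1 real_norm_def)
  have "D \<ge> 0" using D[of 0] by simp
  have w_le: "w m \<le> D * real m powr (1 - p)" for m
  proof (cases "m = 0")
    case False
    have "w m = (g m * real m powr p) * real m powr (1 - p)"
      using False powr_Suc(2)[of "real m"] by (simp add: w_def)
    also have "\<dots> \<le> D * real m powr (1 - p)" using D by (intro mult_right_mono) auto
    finally show ?thesis .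
  qed (use \<open>D \<ge> 0\<close> in \<open>auto simp: w_def\<close>)
  have "summable (\<lambda>n. D * real n powr (1 - p))"
    using p by (intro summable_mult) (simp add: summable_real_powr_iff)
  hence w: "summable w"
    by (rule summable_comparison_test'[of _ 0]) (simp add: w_nonneg w_le)
  have "g m \<le> w m" for m using g_0 g_nonneg[of m] by (cases m) (auto simp: w_def algebra_simps)
  thus g: "summable g"
    by (intro summable_comparison_test'[OF w, of 0]) (simp add: g_nonneg)
  define W where "W = suminf w"
  define C where "C = suminf c"
  have c: "summable c" using c_sums[OF g] by (simp add: sums_iff)
  have C: "C = exp (suminf g)" using c_sums[OF g] by (simp add: sums_iff C_def)
  have W: "(\<Sum>i\<in>A. w (n - i)) \<le> W" if "A \<subseteq> {..<n}" for A n
  proof -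
    have "(\<Sum>i\<in>A. w (n - i)) = sum w ((\<lambda>i. n - i) ` A)"
      using that by (subst sum.reindex) (auto simp: inj_on_def)
    also have "\<dots> \<le> W"
      unfolding W_def using w w_nonneg finite_subset[OF that] by (intro sum_le_suminf) auto
    finally show ?thesis .
  qed
  have "W \<ge> 0" using W[of "{}" 0] by simp

  \<comment> \<open>The summands with \<open>2 * i < n\<close> give the limit; the other ones are of smaller order.\<close>
  define head where "head = (\<lambda>n. \<Sum>i | i < n \<and> 2 * i < n. w (n - i) * c i)"
  define tail where "tail = (\<lambda>n. \<Sum>i | i < n \<and> n \<le> 2 * i. w (n - i) * c i)"
  have split: "real n * c n = head n + tail n" for n
  proof -
    have "{..<n} = {i. i < n \<and> 2 * i < n} \<union> {i. i < n \<and> n \<le> 2 * i}" by auto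
    hence "real n * c n = (\<Sum>i\<in>{i. i < n \<and> 2 * i < n} \<union> {i. i < n \<and> n \<le> 2 * i}. w (n - i) * c i)"
      unfolding rec w_def by metis
    also have "\<dots> = head n + tail n"
      unfolding head_def tail_def by (intro sum.union_disjoint) auto
    finally show ?thesis .
  qed
  have head_term: "real n powr (p - 1) * w (n - i) \<le> D * 2 powr (p - 1)" if "2 * i < n" for n i
  proof -
    have "real n powr (p - 1) * w (n - i) \<le> (2 * real (n - i)) powr (p - 1) * w (n - i)"
      using that p w_nonneg by (intro mult_right_mono powr_mono2) auto
    also have "\<dots> = 2 powr (p - 1) * (g (n - i) * real (n - i) powr p)"
      using that by (simp add: powr_mult powr_Suc(1)[of "real (n - i)", symmetric] w_def del: of_nat_diff)
    also have "\<dots> \<le> 2 powr (p - 1) * D" using D by (intro mult_left_mono) auto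
    finally show ?thesis by (simp add: mult.commute)
  qed
  have tail_bound: "real n powr p * tail n \<le> K * 2 powr p * W"
    if K: "\<And>i. 1 \<le> i \<Longrightarrow> i < n \<Longrightarrow> c i * real i powr p \<le> K" "K \<ge> 0" for n K
  proof -
    have "real n powr p * tail n = (\<Sum>i | i < n \<and> n \<le> 2 * i. w (n - i) * (real n powr p * c i))"
      by (simp add: tail_def sum_distrib_left mult_ac)
    also have "\<dots> \<le> (\<Sum>i | i < n \<and> n \<le> 2 * i. w (n - i) * (2 powr p * K))"
    proof (intro sum_mono mult_left_mono w_nonneg)
      fix i assume i: "i \<in> {i. i < n \<and> n \<le> 2 * i}"
      have "real n powr p * c i \<le> (2 * real i) powr p * c i"
        using i p c_nonneg by (intro mult_right_mono powr_mono2) auto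
      also have "\<dots> = 2 powr p * (c i * real i powr p)" by (simp add: powr_mult)
      also have "\<dots> \<le> 2 powr p * K" using i by (intro mult_left_mono K) auto
      finally show "real n powr p * c i \<le> 2 powr p * K" .
    qed
    also have "\<dots> = (2 powr p * K) * (\<Sum>i | i < n \<and> n \<le> 2 * i. w (n - i))"
      by (simp add: sum_distrib_left mult_ac)
    also have "\<dots> \<le> (2 powr p * K) * W" using K by (intro mult_left_mono W) auto
    finally show ?thesis by (simp add: mult_ac)
  qed
  have c_powr: "c n * real n powr p = real n powr (p - 1) * head n + real n powr p * tail n / real n"
    if "n > 0" for n
  proof -
    have "c n * real n powr p = real n * c n * real n powr (p - 1)"
      using that by (simp add: powr_Suc(1)[of "real n", symmetric])
    also have "\<dots> = real n powr (p - 1) * head n + (real n powr (p - 1) * real n) * tail n / real n"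
      using that by (simp add: split algebra_simps)
    finally show ?thesis
      using that by (simp add: powr_Suc(1))
  qed
  have head_bound: "real n powr (p - 1) * head n \<le> D * 2 powr (p - 1) * C" for n
  proof -
    have "real n powr (p - 1) * head n = (\<Sum>i | i < n \<and> 2 * i < n. (real n powr (p - 1) * w (n - i)) * c i)"
      by (simp add: head_def sum_distrib_left mult_ac)
    also have "\<dots> \<le> (\<Sum>i | i < n \<and> 2 * i < n. (D * 2 powr (p - 1)) * c i)"
      by (intro sum_mono mult_right_mono head_term c_nonneg) auto
    also have "\<dots> = D * 2 powr (p - 1) * (\<Sum>i | i < n \<and> 2 * i < n. c i)"
      by (simp add: sum_distrib_left)
    also have "\<dots> \<le> D * 2 powr (p - 1) * C"
      unfolding C_def using c c_nonneg \<open>D \<ge> 0\<close> by (intro mult_left_mono sum_le_suminf) auto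
    finally show ?thesis .
  qed

  \<comment> \<open>Bootstrap for \<open>c i \<le> K * i powr (- p)\<close>: beyond \<open>n0\<close> the bound on smaller indices enters the tail
    with a factor of at most one half.\<close>
  obtain n0 where n0: "real n0 \<ge> 2 * (2 powr p * W)" using real_arch_simple by blast
  define K where "K = 2 * (D * 2 powr (p - 1) * C) + (\<Sum>i\<le>n0. c i * real i powr p)"
  have nonneg: "D * 2 powr (p - 1) * C \<ge> 0" "(\<Sum>i\<le>n0. c i * real i powr p) \<ge> 0"
    using \<open>D \<ge> 0\<close> c_nonneg by (auto simp: C intro!: sum_nonneg)
  have K: "K \<ge> 0" using nonneg by (simp add: K_def)
  have c_le: "c n * real n powr p \<le> K" if "n \<ge> 1" for n
    using that
  proof (induction n rule: less_induct)
    case (less n)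
    show ?case
    proof (cases "n \<le> n0")
      case True
      have "c n * real n powr p \<le> (\<Sum>i\<le>n0. c i * real i powr p)"
        using True c_nonneg by (intro member_le_sum) auto
      thus ?thesis using nonneg by (simp add: K_def)
    next
      case False
      have "real n powr p * tail n / real n \<le> K * (2 powr p * W) / real n"
        using tail_bound[of n K] less K by (intro divide_right_mono) (auto simp: mult_ac)
      also have "\<dots> \<le> K * (real n / 2) / real n"
        using n0 False K by (intro divide_right_mono mult_left_mono) auto
      also have "\<dots> = K / 2" using less.prems by simp
      finally show ?thesis
        using c_powr[of n] head_bound[of n] less.prems nonneg K_def by linarith
    qed
  qed

  have "(\<lambda>n. real n powr (p - 1) * head n) \<longlonglongrightarrow> (\<Sum>i. \<gamma> * c i)"
  proof -
    define u where "u = (\<lambda>i n. if 2 * i < n then real n powr (p - 1) * w (n - i) * c i else 0)"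
    have lim_u: "(\<lambda>n. u i n) \<longlonglongrightarrow> \<gamma> * c i" for i
    proof -
      have "(\<lambda>n. (real (n + i) / real n) powr (p - 1) * (g n * real n powr p) * c i)
              \<longlonglongrightarrow> 1 powr (p - 1) * \<gamma> * c i"
      proof (intro tendsto_intros lim)
        show "(\<lambda>n. real (n + i) / real n) \<longlonglongrightarrow> 1"
        proof -
          have "(\<lambda>n. 1 + real i / real n) \<longlonglongrightarrow> 1 + 0"
            by (intro tendsto_intros lim_const_over_n)
          moreover have "eventually (\<lambda>n. 1 + real i / real n = real (n + i) / real n) sequentially"
            using eventually_gt_at_top[of 0] by eventually_elim (simp add: field_simps)
          ultimately show ?thesis by (simp add: tendsto_cong)
        qed
      qed auto
      moreover have "eventually (\<lambda>n. (real (n + i) / real n) powr (p - 1) * (g n * real n powr p) * c i = u i (n + i)) sequentially"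
        using eventually_gt_at_top[of i]
        by eventually_elim (simp add: u_def powr_divide powr_Suc(1)[of "real _", symmetric] w_def)
      ultimately have "(\<lambda>n. u i (n + i)) \<longlonglongrightarrow> \<gamma> * c i"
        by (simp add: tendsto_cong)
      thus ?thesis by (rule LIMSEQ_offset)
    qed
    have "eventually (\<lambda>(i,n). norm (u i n) \<le> D * 2 powr (p - 1) * c i) (at_top \<times>\<^sub>F sequentially)"
    proof (intro always_eventually allI, clarify)
      fix i n show "norm (u i n) \<le> D * 2 powr (p - 1) * c i"
        using head_term[of i n] w_nonneg c_nonneg \<open>D \<ge> 0\<close>
        by (auto simp: u_def abs_mult intro!: mult_right_mono)
    qed
    hence "(\<lambda>n. \<Sum>i. u i n) \<longlonglongrightarrow> (\<Sum>i. \<gamma> * c i)"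
      using tannerys_theorem[of u "\<lambda>i. \<gamma> * c i" sequentially "\<lambda>i. D * 2 powr (p - 1) * c i"]
        lim_u summable_mult[OF c] by auto
    moreover have "(\<Sum>i. u i n) = real n powr (p - 1) * head n" for n
    proof -
      have "(\<Sum>i. u i n) = (\<Sum>i | i < n \<and> 2 * i < n. u i n)"
        by (intro suminf_finite) (auto simp: u_def)
      also have "\<dots> = real n powr (p - 1) * head n"
        by (simp add: head_def u_def sum_distrib_left mult_ac)
      finally show ?thesis .
    qed
    ultimately show ?thesis by simp
  qed
  moreover have "(\<lambda>n. real n powr p * tail n / real n) \<longlonglongrightarrow> 0"
  proof (rule tendsto_sandwich)
    show "eventually (\<lambda>n. 0 \<le> real n powr p * tail n / real n) sequentially"
      unfolding tail_def using w_nonneg c_nonneg by (auto intro!: always_eventually sum_nonneg divide_nonneg_nonneg mult_nonneg_nonneg)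
    show "eventually (\<lambda>n. real n powr p * tail n / real n \<le> K * 2 powr p * W / real n) sequentially"
      using tail_bound c_le K by (intro always_eventually allI divide_right_mono) auto
  qed (auto intro: lim_const_over_n)
  ultimately have "(\<lambda>n. real n powr (p - 1) * head n + real n powr p * tail n / real n)
      \<longlonglongrightarrow> (\<Sum>i. \<gamma> * c i) + 0"
    by (intro tendsto_add)
  moreover have "(\<Sum>i. \<gamma> * c i) = \<gamma> * exp (suminf g)"
    using c by (simp add: suminf_mult C[symmetric] C_def)
  moreover have "eventually (\<lambda>n. real n powr (p - 1) * head n + real n powr p * tail n / real n
      = c n * real n powr p) sequentially"
    using eventually_gt_at_top[of 0] by eventually_elim (simp add: c_powr)
  ultimately show "(\<lambda>n. c n * real n powr p) \<longlonglongrightarrow> \<gamma> * exp (\<Sum>m. g m)"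
    by (simp add: tendsto_cong)
qed

end

section \<open>Multisets of weighted elements\<close>

definition weighted_multisets :: "'a set \<Rightarrow> ('a \<Rightarrow> nat) \<Rightarrow> nat \<Rightarrow> 'a multiset set" where
  "weighted_multisets T w n = {M. set_mset M \<subseteq> T \<and> (\<Sum>s\<in>#M. w s) = n}"

text \<open>
  The coefficient of \<open>x ^ n\<close> in the product of \<open>1 / (1 - z * x ^ w s)\<close> over all types \<open>s\<close>.
\<close>

definition multiset_gf :: "'a set \<Rightarrow> ('a \<Rightarrow> nat) \<Rightarrow> real \<Rightarrow> nat \<Rightarrow> real" where
  "multiset_gf T w z n = (\<Sum>M\<in>weighted_multisets T w n. z ^ size M)"

lemma sum_mset_eq_sum_count:
  fixes f :: "'a \<Rightarrow> nat"
  shows "(\<Sum>s\<in>#M. f s) = (\<Sum>s\<in>set_mset M. count M s * f s)"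
proof -
  have "(\<Sum>s\<in>#M. f s) = (\<Sum>s\<in>A. count M s * f s)" if "finite A" "set_mset M \<subseteq> A" for A
    using that(2)
  proof (induction M)
    case (add x M)
    have "(\<Sum>s\<in>A. count (add_mset x M) s * f s) = (\<Sum>s\<in>A. count M s * f s + (if s = x then f s else 0))"
      by (intro sum.cong) auto
    also have "\<dots> = (\<Sum>s\<in>A. count M s * f s) + f x"
      using add.prems that(1) by (simp add: sum.distrib)
    finally show ?case using add by simp
  qed auto
  thus ?thesis by auto
qed

locale weighted_types =
  fixes T :: "'a set" and w :: "'a \<Rightarrow> nat"
  assumes finite_weight: "\<And>d. finite {s\<in>T. w s = d}"
    and weight_pos: "\<And>s. s \<in> T \<Longrightarrow> w s \<ge> 1"
begin

lemma finite_weighted_multisets: "finite (weighted_multisets T w n)"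
proof -
  have "{s\<in>T. w s \<le> n} = (\<Union>d\<le>n. {s\<in>T. w s = d})" by auto
  hence fin: "finite {s\<in>T. w s \<le> n}" using finite_weight by simp
  have "M \<in> (\<Union>k\<le>n. multisets_of_size {s\<in>T. w s \<le> n} k)"
    if M: "M \<in> weighted_multisets T w n" for M
  proof -
    have "w s \<le> n" if "s \<in># M" for s
      using M that unfolding weighted_multisets_def by (auto dest!: multi_member_split)
    moreover have "size M \<le> (\<Sum>s\<in>#M. w s)"
    proof -
      have "size M = (\<Sum>s\<in>#M. 1)" by simp
      also have "\<dots> \<le> (\<Sum>s\<in>#M. w s)"
        using M weight_pos by (intro sum_mset_mono) (auto simp: weighted_multisets_def)
      finally show ?thesis .
    qed
    ultimately show ?thesis
      using M by (auto simp: weighted_multisets_def multisets_of_size_def)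
  qed
  hence "weighted_multisets T w n \<subseteq> (\<Union>k\<le>n. multisets_of_size {s\<in>T. w s \<le> n} k)" by blast
  thus ?thesis
    by (rule finite_subset) (use fin in \<open>auto intro!: finite_multisets_of_size\<close>)
qed

lemma multiset_gf_0: "multiset_gf T w z 0 = 1"
proof -
  have "weighted_multisets T w 0 = {{#}}"
  proof -
    have "M = {#}" if M: "set_mset M \<subseteq> T" "(\<Sum>s\<in>#M. w s) = 0" for M
    proof (cases M)
      case (add s N)
      thus ?thesis using M weight_pos[of s] by simp
    qed
    thus ?thesis by (auto simp: weighted_multisets_def)
  qed
  thus ?thesis by (simp add: multiset_gf_def)
qed

text \<open>
  Each multiset of weight \<open>n\<close> is counted \<open>n\<close> times by choosing an element \<open>s\<close> of it, a number \<open>k\<close> from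
  \<open>1\<close> to the multiplicity of \<open>s\<close>, and one of \<open>w s\<close> units. Removing \<open>k\<close> copies of \<open>s\<close> leaves an arbitrary
  multiset of weight \<open>n - k * w s\<close>; on the right-hand side \<open>d = w s\<close> and \<open>k = (n - i) div d\<close>.
\<close>

lemma multiset_gf_rec:
  "real n * multiset_gf T w z n =
     (\<Sum>i<n. (\<Sum>d | d \<in> {1..n-i} \<and> d dvd n - i.
        real d * real (card {s\<in>T. w s = d}) * z ^ ((n - i) div d)) * multiset_gf T w z i)"
proof -
  let ?W = "weighted_multisets T w"
  have remove_copies: thesis
    if "k \<le> count M s" "\<And>M'. M = M' + replicate_mset k s \<Longrightarrow> thesis" for M :: "'a multiset" and k s thesis
    using that by (metis count_le_replicate_mset_subset_eq subset_mset.diff_add)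
  let ?D = "\<lambda>m. {d. d \<in> {1..m} \<and> d dvd m}"
  let ?T = "\<lambda>d. {s\<in>T. w s = d}"
  have "real n * multiset_gf T w z n = (\<Sum>M\<in>?W n. \<Sum>s\<in>set_mset M. \<Sum>k\<in>{1..count M s}. real (w s) * z ^ size M)"
    unfolding multiset_gf_def sum_distrib_left
  proof (rule sum.cong[OF refl])
    fix M assume "M \<in> ?W n"
    hence "n = (\<Sum>s\<in>set_mset M. count M s * w s)"
      by (auto simp: weighted_multisets_def sum_mset_eq_sum_count)
    thus "real n * z ^ size M = (\<Sum>s\<in>set_mset M. \<Sum>k\<in>{1..count M s}. real (w s) * z ^ size M)"
      by (simp add: sum_distrib_right sum_distrib_left mult_ac)
  qed
  also have "\<dots> = (\<Sum>(M,s,k)\<in>(SIGMA M:?W n. SIGMA s:set_mset M. {1..count M s}). real (w s) * z ^ size M)"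
    by (simp add: sum.Sigma finite_weighted_multisets del: sum_constant)
  also have "\<dots> = (\<Sum>(i,d,s,M)\<in>(SIGMA i:{..<n}. SIGMA d:?D (n - i). SIGMA s:?T d. ?W i).
      real d * z ^ ((n - i) div d) * z ^ size M)"
  proof (rule sum.reindex_bij_witness[
      where i = "\<lambda>(i,d,s,M). (M + replicate_mset ((n - i) div d) s, s, (n - i) div d)"
        and j = "\<lambda>(M,s,k). (n - k * w s, w s, s, M - replicate_mset k s)"], goal_cases)
    case (1 a)
    then obtain M s k where a: "a = (M,s,k)" "M \<in> ?W n" "s \<in># M" "1 \<le> k" "k \<le> count M s" by auto
    obtain M' where M': "M = M' + replicate_mset k s" using a(5) by (rule remove_copies)
    have "w s \<ge> 1" "n = (\<Sum>s\<in>#M'. w s) + k * w s"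
      using a weight_pos[of s] by (auto simp: weighted_multisets_def M')
    thus ?case using a by (auto simp: M')
  next
    case (2 a)
    then obtain M s k where a: "a = (M,s,k)" "M \<in> ?W n" "s \<in># M" "1 \<le> k" "k \<le> count M s" by auto
    obtain M' where M': "M = M' + replicate_mset k s" using a(5) by (rule remove_copies)
    have s: "w s \<ge> 1" "s \<in> T" "n = (\<Sum>s\<in>#M'. w s) + k * w s" "set_mset M' \<subseteq> T"
      using a weight_pos[of s] by (auto simp: weighted_multisets_def M')
    moreover have "k * w s \<ge> 1" "k * w s \<ge> w s" using s a by auto
    ultimately show ?case using a by (auto simp: M' weighted_multisets_def)
  next
    case (3 b)
    then obtain i d s M where b: "b = (i,d,s,M)" "i < n" "1 \<le> d" "d dvd n - i" "s \<in> T" "w s = d" "M \<in> ?W i"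
      by auto
    thus ?case by auto
  next
    case (4 b)
    then obtain i d s M where b: "b = (i,d,s,M)" "i < n" "1 \<le> d" "d dvd n - i" "s \<in> T" "w s = d" "M \<in> ?W i"
      by auto
    moreover have "(n - i) div d \<ge> 1"
      using b dvd_imp_le[of d "n - i"] by (simp add: Suc_le_eq div_greater_zero_iff)
    ultimately show ?case
      by (auto simp: weighted_multisets_def)
  next
    case (5 a)
    then obtain M s k where a: "a = (M,s,k)" "M \<in> ?W n" "s \<in># M" "1 \<le> k" "k \<le> count M s" by auto
    obtain M' where M': "M = M' + replicate_mset k s" using a(5) by (rule remove_copies)
    have "w s \<ge> 1" "n = (\<Sum>s\<in>#M'. w s) + k * w s"
      using a weight_pos[of s] by (auto simp: weighted_multisets_def M')
    thus ?case using a by (auto simp: M' power_add)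
  qed
  also have "\<dots> = (\<Sum>i<n. \<Sum>d\<in>?D (n - i). \<Sum>s\<in>?T d. \<Sum>M\<in>?W i. real d * z ^ ((n - i) div d) * z ^ size M)"
    by (simp add: sum.Sigma finite_weighted_multisets finite_weight del: sum_constant)
  also have "\<dots> = (\<Sum>i<n. (\<Sum>d\<in>?D (n - i).
      real d * real (card {s\<in>T. w s = d}) * z ^ ((n - i) div d)) * multiset_gf T w z i)"
    by (simp add: multiset_gf_def sum_distrib_left sum_distrib_right mult_ac)
  finally show ?thesis .
qed

end

section \<open>Forests as multisets of trees\<close>

definition graph_image :: "('a \<Rightarrow> 'b) \<Rightarrow> 'a set set \<Rightarrow> 'b set set" where
  "graph_image \<pi> E = (\<lambda>e. \<pi> ` e) ` E"

definition induced_edges :: "'a set set \<Rightarrow> 'a set \<Rightarrow> 'a set set" where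
  "induced_edges E A = {e\<in>E. e \<subseteq> A}"

definition component :: "'a set \<Rightarrow> 'a set set \<Rightarrow> 'a \<Rightarrow> 'a set" where
  "component V E v = {u\<in>V. (v, u) \<in> (adj E)\<^sup>*}"

text \<open>
  A canonical name of the isomorphism class: all relabelings of the graph by an initial segment of
  the naturals. The number of vertices is recorded as well since it serves as the weight of the type.
\<close>

definition graph_type :: "'a set \<Rightarrow> 'a set set \<Rightarrow> nat \<times> nat set set set" where
  "graph_type V E = (card V, {graph_image \<pi> E | \<pi>. bij_betw \<pi> V {..<card V}})"

definition component_types :: "'a set \<Rightarrow> 'a set set \<Rightarrow> (nat \<times> nat set set set) multiset" where
  "component_types V E =
     image_mset (\<lambda>A. graph_type A (induced_edges E A)) (mset_set (graph_components V E))"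

lemma reachable_sym: "(u, v) \<in> (adj E)\<^sup>* \<Longrightarrow> (v, u) \<in> (adj E)\<^sup>*"
proof -
  have "sym ((adj E)\<^sup>*)" by (intro sym_rtrancl symI) (auto simp: adj_def insert_commute)
  thus "(u, v) \<in> (adj E)\<^sup>* \<Longrightarrow> (v, u) \<in> (adj E)\<^sup>*" by (blast dest: symD)
qed

lemma graph_components_eq: "graph_components V E = component V E ` V"
  unfolding graph_components_def quotient_def component_def by blast

lemma component_refl: "v \<in> V \<Longrightarrow> v \<in> component V E v"
  by (simp add: component_def)

lemma edgeE:
  assumes "simple_graph V E" "e \<in> E"
  obtains x y where "e = {x, y}" "x \<noteq> y" "x \<in> V" "y \<in> V"
  using assms unfolding simple_graph_def by (metis card_2_iff insert_subset)

lemma simple_graph_edgeD: "simple_graph V E \<Longrightarrow> {x, y} \<in> E \<Longrightarrow> x \<in> V \<and> y \<in> V"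
  by (auto simp: simple_graph_def)

lemma simple_graph_Un:
  "simple_graph V E \<Longrightarrow> simple_graph W F \<Longrightarrow> simple_graph (V \<union> W) (E \<union> F)"
  unfolding simple_graph_def by blast

lemma simple_graph_image:
  assumes "simple_graph V E" "inj_on \<pi> V"
  shows "simple_graph (\<pi> ` V) (graph_image \<pi> E)"
proof -
  have "card (\<pi> ` e) = 2" if "e \<in> E" for e
    using assms that inj_on_subset[OF assms(2), of e] by (auto simp: simple_graph_def card_image)
  thus ?thesis using assms(1) by (auto simp: simple_graph_def graph_image_def)
qed

lemma connected_graph_image:
  assumes "connected_graph V E" "inj_on \<pi> V"
  shows "connected_graph (\<pi> ` V) (graph_image \<pi> E)"
  using assms simple_graph_image rtrancl_adj_image[of _ _ E \<pi>]
  unfolding connected_graph_def graph_image_def by blast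

lemma graph_cycle_map_inv:
  assumes "simple_graph V E" "inj_on \<pi> V" "graph_cycle (graph_image \<pi> E) vs"
  shows "graph_cycle E (map (inv_into V \<pi>) vs)"
proof -
  have edge: "\<exists>e\<in>E. {vs ! i, vs ! (Suc i mod length vs)} = \<pi> ` e" if "i < length vs" for i
    using assms(3) that unfolding graph_cycle_def graph_image_def by blast
  have "vs ! i \<in> \<pi> ` V" if i: "i < length vs" for i
    using edge[OF i] assms(1) unfolding simple_graph_def by blast
  hence "set vs \<subseteq> \<pi> ` V" by (metis in_set_conv_nth subsetI)
  hence "inj_on (inv_into V \<pi>) (set vs)" by (rule inj_on_subset[OF inj_on_inv_into[OF order_refl]])
  moreover have "{inv_into V \<pi> (vs ! i), inv_into V \<pi> (vs ! (Suc i mod length vs))} \<in> E"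
    if i: "i < length vs" for i
  proof -
    obtain e where e: "e \<in> E" "{vs ! i, vs ! (Suc i mod length vs)} = \<pi> ` e" using edge[OF i] by blast
    have "inv_into V \<pi> ` {vs ! i, vs ! (Suc i mod length vs)} = e"
      unfolding e(2) using assms e by (intro inv_into_image_cancel) (auto simp: simple_graph_def)
    thus ?thesis using e(1) by simp
  qed
  moreover have "Suc i mod length vs < length vs" if "i < length vs" for i
    using that by (intro mod_less_divisor) auto
  ultimately show ?thesis
    using assms(3) by (auto simp: graph_cycle_def distinct_map)
qed

lemma forest_image:
  assumes "forest V E" "inj_on \<pi> V"
  shows "forest (\<pi> ` V) (graph_image \<pi> E)"
  using assms graph_cycle_map_inv simple_graph_image unfolding forest_def by blast

lemma tree_image:
  assumes "tree V E" "inj_on \<pi> V"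
  shows "tree (\<pi> ` V) (graph_image \<pi> E)"
  using assms forest_image connected_graph_image unfolding tree_def by blast

text \<open>
  Every edge lies within one of the two vertex sets, so a walk around a cycle can never change sides.
\<close>

lemma graph_cycle_Un_left:
  assumes "simple_graph V E" "simple_graph W F" "V \<inter> W = {}"
    and "graph_cycle (E \<union> F) vs" "vs ! 0 \<in> V"
  shows "graph_cycle E vs"
proof -
  let ?n = "length vs"
  have len: "?n \<ge> 3" and edge: "\<And>i. i < ?n \<Longrightarrow> {vs ! i, vs ! (Suc i mod ?n)} \<in> E \<union> F"
    using assms(4) by (auto simp: graph_cycle_def)
  have E: "{vs ! i, vs ! (Suc i mod ?n)} \<in> E" if "i < ?n" "vs ! i \<in> V" for i
    using edge[OF that(1)] that(2) simple_graph_edgeD[OF assms(2)] assms(3) by blast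
  have "vs ! i \<in> V" if "i < ?n" for i
    using that
  proof (induction i)
    case (Suc i)
    hence "{vs ! i, vs ! Suc i} \<in> E" using E[of i] by simp
    thus ?case using simple_graph_edgeD[OF assms(1)] by blast
  qed (use assms in simp)
  thus ?thesis using assms(4) E by (simp add: graph_cycle_def)
qed

lemma forest_Un:
  assumes "forest V E" "forest W F" "V \<inter> W = {}"
  shows "forest (V \<union> W) (E \<union> F)"
proof -
  have simple: "simple_graph V E" "simple_graph W F" using assms by (auto simp: forest_def)
  have "\<not> graph_cycle (E \<union> F) vs" for vs
  proof
    assume cyc: "graph_cycle (E \<union> F) vs"
    hence "{vs ! 0, vs ! (Suc 0 mod length vs)} \<in> E \<union> F"
      unfolding graph_cycle_def by fastforce
    hence "vs ! 0 \<in> V \<or> vs ! 0 \<in> W" using simple simple_graph_edgeD by (metis Un_iff)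
    hence "graph_cycle E vs \<or> graph_cycle F vs"
      using graph_cycle_Un_left[OF simple assms(3) cyc] graph_cycle_Un_left[OF simple(2,1), of vs] cyc assms(3)
      by (auto simp: Un_commute Int_commute)
    thus False using assms by (auto simp: forest_def)
  qed
  thus ?thesis using simple_graph_Un[OF simple] by (auto simp: forest_def)
qed

lemma component_Un_left:
  assumes "simple_graph V E" "simple_graph W F" "V \<inter> W = {}" "v \<in> V"
  shows "component (V \<union> W) (E \<union> F) v = component V E v"
proof -
  have *: "(v, u) \<in> (adj E)\<^sup>* \<and> u \<in> V" if "(v, u) \<in> (adj (E \<union> F))\<^sup>*" for u
    using that
  proof (induction rule: rtrancl_induct)
    case (step y z)
    hence "{y, z} \<in> E \<union> F" "y \<in> V" by (auto simp: adj_def)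
    hence "{y, z} \<in> E" using simple_graph_edgeD[OF assms(2)] assms(3) by blast
    moreover from this have "z \<in> V" using simple_graph_edgeD[OF assms(1)] by blast
    ultimately show ?case using step.IH by (auto simp: adj_def intro: rtrancl_into_rtrancl)
  qed (use assms in auto)
  have "adj E \<subseteq> adj (E \<union> F)" by (auto simp: adj_def)
  hence "(adj E)\<^sup>* \<subseteq> (adj (E \<union> F))\<^sup>*" by (rule rtrancl_mono)
  thus ?thesis using * unfolding component_def by blast
qed

lemma graph_components_Un:
  assumes "simple_graph V E" "simple_graph W F" "V \<inter> W = {}"
  shows "graph_components (V \<union> W) (E \<union> F) = graph_components V E \<union> graph_components W F"
proof -
  have "component (V \<union> W) (E \<union> F) v = component V E v" if "v \<in> V" for v
    using component_Un_left[OF assms that] .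
  moreover have "component (V \<union> W) (E \<union> F) v = component W F v" if "v \<in> W" for v
    using component_Un_left[OF assms(2,1) _ that] assms(3) by (simp add: Un_commute Int_commute)
  ultimately show ?thesis
    unfolding graph_components_eq image_Un by (intro arg_cong2[of _ _ _ _ "(\<union>)"] image_cong) auto
qed

lemma finite_graph_components: "finite V \<Longrightarrow> finite (graph_components V E)"
  by (simp add: graph_components_eq)

text \<open>
  Together with \<open>component_types_connected\<close> this lets statements about multisets of component types be
  proved by splitting off one component at a time.
\<close>

lemma component_types_Un:
  assumes "simple_graph V E" "simple_graph W F" "V \<inter> W = {}" "finite V" "finite W"
  shows "component_types (V \<union> W) (E \<union> F) = component_types V E + component_types W F"
proof -
  have sub: "A \<subseteq> V" "A \<noteq> {}" if "A \<in> graph_components V E" for V :: "'a set" and E A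
    using that by (auto simp: graph_components_eq component_def)
  have disj: "graph_components V E \<inter> graph_components W F = {}"
  proof (rule equals0I)
    fix A assume "A \<in> graph_components V E \<inter> graph_components W F"
    thus False using sub[of A V E] sub[of A W F] assms(3) by blast
  qed
  have ind: "induced_edges (E \<union> F) A = induced_edges E A"
    if "A \<subseteq> V" "simple_graph W F" "V \<inter> W = {}" for A V W :: "'a set" and E F
  proof -
    have "\<not> e \<subseteq> A" if e: "e \<in> F" for e
    proof
      assume "e \<subseteq> A"
      moreover have "e \<subseteq> W" "card e = 2" using e \<open>simple_graph W F\<close> by (auto simp: simple_graph_def)
      ultimately have "e = {}" using \<open>A \<subseteq> V\<close> \<open>V \<inter> W = {}\<close> by blast
      thus False using \<open>card e = 2\<close> by simp
    qed
    thus ?thesis by (auto simp: induced_edges_def)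
  qed
  have E: "graph_type A (induced_edges (E \<union> F) A) = graph_type A (induced_edges E A)"
    if "A \<in> graph_components V E" for A
    using ind[of A V W F E] sub[OF that] assms by simp
  have F: "graph_type A (induced_edges (E \<union> F) A) = graph_type A (induced_edges F A)"
    if "A \<in> graph_components W F" for A
    using ind[of A W V E F] sub[OF that] assms by (simp add: Un_commute Int_commute)
  let ?f = "\<lambda>E A. graph_type A (induced_edges E A)"
  have "component_types (V \<union> W) (E \<union> F) =
      image_mset (?f (E \<union> F)) (mset_set (graph_components V E)) +
      image_mset (?f (E \<union> F)) (mset_set (graph_components W F))"
    unfolding component_types_def graph_components_Un[OF assms(1-3)]
    using assms(4,5) by (simp add: mset_set_Union[OF _ _ disj] finite_graph_components)
  also have "image_mset (?f (E \<union> F)) (mset_set (graph_components V E)) = component_types V E"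
    unfolding component_types_def
    using E assms(4) by (intro image_mset_cong) (simp add: finite_graph_components)
  also have "image_mset (?f (E \<union> F)) (mset_set (graph_components W F)) = component_types W F"
    unfolding component_types_def
    using F assms(5) by (intro image_mset_cong) (simp add: finite_graph_components)
  finally show ?thesis .
qed

lemma graph_components_connected:
  assumes "connected_graph V E"
  shows "graph_components V E = {V}"
proof -
  have "component V E v = V" if "v \<in> V" for v
    using assms that by (auto simp: component_def connected_graph_def)
  thus ?thesis using assms by (auto simp: graph_components_eq connected_graph_def)
qed

lemma component_types_connected:
  assumes "connected_graph V E"
  shows "component_types V E = {#graph_type V E#}"
proof -
  have "induced_edges E V = E"
    using assms by (auto simp: induced_edges_def connected_graph_def simple_graph_def)
  thus ?thesis by (simp add: component_types_def graph_components_connected[OF assms])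
qed

lemma forest_split_component:
  assumes "forest V E" "A \<in> graph_components V E"
  shows "tree A (induced_edges E A)" "forest (V - A) (induced_edges E (V - A))"
    "A \<subseteq> V" "E = induced_edges E A \<union> induced_edges E (V - A)"
proof -
  obtain v where v: "v \<in> V" "A = component V E v" using assms(2) by (auto simp: graph_components_eq)
  show AV: "A \<subseteq> V" by (auto simp: v component_def)
  have simple: "simple_graph V E" using assms(1) by (simp add: forest_def)
  have closed: "y \<in> A" if "{x, y} \<in> E" "x \<in> A" for x y
  proof -
    have "y \<in> V" using simple that(1) by (auto simp: simple_graph_def)
    moreover have "(x, y) \<in> adj E" using that(1) by (simp add: adj_def)
    ultimately show ?thesis using that(2) v by (auto simp: component_def intro: rtrancl_into_rtrancl)
  qed
  have "e \<subseteq> A \<or> e \<subseteq> V - A" if e: "e \<in> E" for e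
  proof -
    obtain x y where xy: "e = {x, y}" "x \<in> V" "y \<in> V" using edgeE[OF simple e] by metis
    thus ?thesis using closed[of x y] closed[of y x] e by (auto simp: insert_commute)
  qed
  thus "E = induced_edges E A \<union> induced_edges E (V - A)" by (auto simp: induced_edges_def)
  have forest: "forest B (induced_edges E B)" for B
  proof -
    have "graph_cycle E vs" if "graph_cycle (induced_edges E B) vs" for vs
      using that by (auto simp: graph_cycle_def induced_edges_def)
    thus ?thesis
      using assms(1) by (auto simp: forest_def simple_graph_def induced_edges_def)
  qed
  show "forest (V - A) (induced_edges E (V - A))" by (rule forest)
  have reach: "(v, u) \<in> (adj (induced_edges E A))\<^sup>*" if "u \<in> A" for u
  proof -
    have "(v, u) \<in> (adj E)\<^sup>*" using that v by (simp add: component_def)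
    hence "(v, u) \<in> (adj (induced_edges E A))\<^sup>* \<and> u \<in> A"
    proof (induction rule: rtrancl_induct)
      case base
      show ?case using v component_refl by auto
    next
      case (step y z)
      hence "{y, z} \<in> E" by (simp add: adj_def)
      hence "z \<in> A" "{y, z} \<in> induced_edges E A"
        using step.IH closed by (auto simp: induced_edges_def)
      thus ?case using step.IH by (auto simp: adj_def intro: rtrancl_into_rtrancl)
    qed
    thus ?thesis ..
  qed
  have "connected_graph A (induced_edges E A)"
    unfolding connected_graph_def
  proof (intro conjI ballI)
    show "simple_graph A (induced_edges E A)" using forest[of A] by (simp add: forest_def)
    show "A \<noteq> {}" using component_refl[OF v(1), of E] v(2) by blast
    show "(x, y) \<in> (adj (induced_edges E A))\<^sup>*" if "x \<in> A" "y \<in> A" for x y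
      using reach[OF that(2)] reachable_sym[OF reach[OF that(1)]] by (rule rtrancl_trans[rotated])
  qed
  thus "tree A (induced_edges E A)" using forest by (simp add: tree_def)
qed

text \<open>
  By \<open>forest_split_component\<close>, no edge leaves a component, so removing a component leaves a forest.
\<close>

lemma forest_induct [consumes 2, case_names empty add]:
  assumes "finite V" "forest V E"
    and "P {} {}"
    and "\<And>A E W F. tree A E \<Longrightarrow> forest W F \<Longrightarrow> finite A \<Longrightarrow> finite W \<Longrightarrow> A \<inter> W = {} \<Longrightarrow>
           P W F \<Longrightarrow> P (A \<union> W) (E \<union> F)"
  shows "P V E"
  using assms(1,2)
proof (induction V arbitrary: E rule: finite_psubset_induct)
  case (psubset V)
  show ?case
  proof (cases "V = {}")
    case True
    hence "E = {}" using psubset.prems by (auto simp: forest_def simple_graph_def)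
    thus ?thesis using True assms(3) by simp
  next
    case False
    then obtain A where A: "A \<in> graph_components V E" by (auto simp: graph_components_eq)
    note split = forest_split_component[OF psubset.prems A]
    have "A \<noteq> {}" using split(1) by (simp add: tree_def connected_graph_def)
    hence "P (V - A) (induced_edges E (V - A))"
      using split by (intro psubset.IH) auto
    hence "P (A \<union> (V - A)) (induced_edges E A \<union> induced_edges E (V - A))"
      using split psubset.hyps finite_subset by (intro assms(4)) auto
    thus ?thesis using split(3) split(4)[symmetric] by (simp add: Un_absorb1)
  qed
qed

lemma graph_image_comp: "graph_image \<rho> (graph_image \<pi> E) = graph_image (\<rho> \<circ> \<pi>) E"
  by (simp add: graph_image_def image_image image_comp)

lemma graph_image_Un: "graph_image \<pi> (E \<union> F) = graph_image \<pi> E \<union> graph_image \<pi> F"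
  by (simp add: graph_image_def image_Un)

lemma graph_image_cong:
  assumes "simple_graph V E" "\<And>x. x \<in> V \<Longrightarrow> \<pi> x = \<rho> x"
  shows "graph_image \<pi> E = graph_image \<rho> E"
  unfolding graph_image_def
  using assms by (intro image_cong refl) (auto simp: simple_graph_def subset_iff)

lemma graph_type_image:
  assumes "simple_graph V E" "bij_betw \<pi> V W"
  shows "graph_type W (graph_image \<pi> E) = graph_type V E"
proof -
  have card: "card W = card V" using bij_betw_same_card[OF assms(2)] by simp
  have "{graph_image \<rho> (graph_image \<pi> E) |\<rho>. bij_betw \<rho> W {..<card V}} =
        {graph_image \<rho> E |\<rho>. bij_betw \<rho> V {..<card V}}" (is "?L = ?R")
  proof
    show "?L \<subseteq> ?R" unfolding graph_image_comp using bij_betw_trans[OF assms(2)] by blast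
    show "?R \<subseteq> ?L"
    proof
      fix F assume "F \<in> ?R"
      then obtain \<rho> where \<rho>: "bij_betw \<rho> V {..<card V}" "F = graph_image \<rho> E" by blast
      let ?\<sigma> = "\<rho> \<circ> inv_into V \<pi>"
      have "bij_betw ?\<sigma> W {..<card V}" by (rule bij_betw_trans[OF bij_betw_inv_into[OF assms(2)] \<rho>(1)])
      moreover have "graph_image ?\<sigma> (graph_image \<pi> E) = F"
        unfolding graph_image_comp \<rho>(2) using assms(2)
        by (intro graph_image_cong[OF assms(1)]) (auto simp: bij_betw_def)
      ultimately show "F \<in> ?L" by blast
    qed
  qed
  thus ?thesis by (simp add: graph_type_def card)
qed

lemma graph_type_eqD:
  assumes "simple_graph V E" "simple_graph W F" "finite V" "finite W"
    and "graph_type V E = graph_type W F"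
  obtains \<pi> where "bij_betw \<pi> V W" "F = graph_image \<pi> E"
proof -
  note eqs = assms(5)[unfolded graph_type_def prod.inject]
  obtain \<rho> where \<rho>: "bij_betw \<rho> W {..<card W}"
    using ex_bij_betw_finite_nat[OF assms(4)] by (auto simp: atLeast0LessThan)
  then obtain \<sigma> where "bij_betw \<sigma> V {..<card V}" "graph_image \<rho> F = graph_image \<sigma> E"
    using conjunct2[OF eqs] by blast
  hence \<sigma>: "bij_betw \<sigma> V {..<card W}" "graph_image \<rho> F = graph_image \<sigma> E"
    using conjunct1[OF eqs] by auto
  have "graph_image (inv_into W \<rho> \<circ> \<sigma>) E = graph_image (inv_into W \<rho>) (graph_image \<rho> F)"
    by (simp add: graph_image_comp \<sigma>)
  also have "\<dots> = graph_image id F"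
    unfolding graph_image_comp using \<rho>
    by (intro graph_image_cong[OF assms(2)]) (auto simp: bij_betw_def)
  finally have "F = graph_image (inv_into W \<rho> \<circ> \<sigma>) E" by (simp add: graph_image_def)
  thus ?thesis
    using bij_betw_trans[OF \<sigma>(1) bij_betw_inv_into[OF \<rho>]] that by blast
qed

lemma component_types_image:
  assumes "finite V" "forest V E" "inj_on \<pi> V"
  shows "component_types (\<pi> ` V) (graph_image \<pi> E) = component_types V E"
  using assms
proof (induction rule: forest_induct)
  case empty
  show ?case by (simp add: component_types_def graph_components_eq)
next
  case (add A E W F)
  have s: "simple_graph A E" "simple_graph W F" "connected_graph A E"
    using add by (auto simp: tree_def forest_def)
  have inj: "inj_on \<pi> A" "inj_on \<pi> W" using add.prems by (auto simp: inj_on_Un)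
  have "\<pi> ` A \<inter> \<pi> ` W = {}"
    using add.prems add.hyps by (simp flip: inj_on_image_Int[OF add.prems, of A W])
  hence "component_types (\<pi> ` (A \<union> W)) (graph_image \<pi> (E \<union> F)) =
      component_types (\<pi> ` A) (graph_image \<pi> E) + component_types (\<pi> ` W) (graph_image \<pi> F)"
    unfolding image_Un graph_image_Un using s inj add.hyps
    by (intro component_types_Un simple_graph_image) auto
  also have "component_types (\<pi> ` A) (graph_image \<pi> E) = component_types A E"
    using s inj graph_type_image[OF s(1) inj_on_imp_bij_betw[OF inj(1)]]
    by (simp add: component_types_connected connected_graph_image)
  also have "component_types A E + component_types (\<pi> ` W) (graph_image \<pi> F) = component_types (A \<union> W) (E \<union> F)"
    using add s inj by (simp add: component_types_Un)
  finally show ?case .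
qed

text \<open>
  A forest is determined up to isomorphism by its component types: a tree of the first forest has a
  partner of the same type in the second one, both are removed, and the isomorphism of the two trees
  is glued to the one obtained by induction for what remains.
\<close>

lemma isomorphic_if_component_types_eq:
  assumes "finite V" "forest V E" "finite W" "forest W F" "component_types V E = component_types W F"
  obtains \<pi> where "bij_betw \<pi> V W" "F = graph_image \<pi> E"
proof -
  have "\<exists>\<pi>. bij_betw \<pi> V W \<and> F = graph_image \<pi> E"
    using assms
  proof (induction arbitrary: W F rule: forest_induct)
    case empty
    hence "graph_components W F = {}"
      by (simp add: component_types_def graph_components_eq mset_set_empty_iff)
    hence "W = {}" by (simp add: graph_components_eq)
    thus ?case using empty by (auto simp: graph_image_def forest_def simple_graph_def bij_betw_def)
  next
    case (add A E V' E')
    have s: "simple_graph A E" "simple_graph V' E'" "connected_graph A E"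
      using add by (auto simp: tree_def forest_def)
    have eq: "{#graph_type A E#} + component_types V' E' = component_types W F"
      using add.prems(3) s add.hyps by (simp add: component_types_Un component_types_connected)
    hence "graph_type A E \<in># component_types W F" by (metis union_single_eq_member add_mset_add_single union_commute)
    then obtain B where B: "B \<in> graph_components W F" "graph_type A E = graph_type B (induced_edges F B)"
      using finite_graph_components[OF add.prems(1)] by (auto simp: component_types_def)
    note split = forest_split_component[OF add.prems(2) B(1)]
    let ?W' = "W - B" and ?F' = "induced_edges F (W - B)"
    have t: "simple_graph B (induced_edges F B)" "simple_graph ?W' ?F'" "connected_graph B (induced_edges F B)"
      using split by (auto simp: tree_def forest_def)
    have fin: "finite B" "finite ?W'" using split add.prems(1) finite_subset by auto
    have W: "W = B \<union> ?W'" using split by auto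
    have "component_types W F = component_types (B \<union> ?W') (induced_edges F B \<union> ?F')"
      using W split(4) by simp
    also have "\<dots> = {#graph_type A E#} + component_types ?W' ?F'"
      using t fin by (subst component_types_Un) (auto simp: component_types_connected B(2))
    finally have "component_types V' E' = component_types ?W' ?F'" using eq by simp
    then obtain \<rho> where \<rho>: "bij_betw \<rho> V' ?W'" "?F' = graph_image \<rho> E'"
      using add.IH[OF fin(2) split(2)] by blast
    obtain \<sigma> where \<sigma>: "bij_betw \<sigma> A B" "induced_edges F B = graph_image \<sigma> E"
      using graph_type_eqD[OF s(1) t(1) add.hyps(3) fin(1) B(2)] .
    define \<pi> where "\<pi> = (\<lambda>x. if x \<in> A then \<sigma> x else \<rho> x)"
    have "bij_betw \<pi> A B" using \<sigma>(1) by (subst bij_betw_cong[of A \<pi> \<sigma>]) (auto simp: \<pi>_def)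
    moreover have "bij_betw \<pi> V' ?W'"
      using \<rho>(1) add.hyps by (subst bij_betw_cong[of V' \<pi> \<rho>]) (auto simp: \<pi>_def)
    ultimately have "bij_betw \<pi> (A \<union> V') (B \<union> ?W')" by (rule bij_betw_combine) auto
    moreover have "graph_image \<pi> E = graph_image \<sigma> E" "graph_image \<pi> E' = graph_image \<rho> E'"
      using s add.hyps by (auto intro!: graph_image_cong simp: \<pi>_def)
    hence "graph_image \<pi> (E \<union> E') = F"
      using split(4) \<sigma>(2) \<rho>(2) by (simp add: graph_image_Un)
    ultimately show ?case using W by metis
  qed
  thus ?thesis using that by blast
qed

definition tree_types :: "(nat \<times> nat set set set) set" where
  "tree_types = (SIGMA d:UNIV. unlabeled_trees d)"

lemma graph_iso_class:
  assumes "simple_graph V E"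
  shows "graph_iso V `` {E} = {graph_image \<pi> E |\<pi>. bij_betw \<pi> V V}"
proof -
  have "simple_graph V (graph_image \<pi> E)" if "bij_betw \<pi> V V" for \<pi>
    using simple_graph_image[OF assms, of \<pi>] that by (auto simp: bij_betw_def)
  thus ?thesis using assms unfolding graph_iso_def graph_image_def by auto
qed

lemma graph_type_lessThan:
  "simple_graph {..<n} E \<Longrightarrow> graph_type {..<n} E = (n, graph_iso {..<n} `` {E})"
  by (simp add: graph_type_def graph_iso_class)

lemma graph_type_tree_in_tree_types:
  assumes "finite V" "tree V E"
  shows "graph_type V E \<in> tree_types"
proof -
  obtain \<pi> where \<pi>: "bij_betw \<pi> V {..<card V}"
    using ex_bij_betw_finite_nat[OF assms(1)] by (auto simp: atLeast0LessThan)
  let ?F = "graph_image \<pi> E"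
  have F: "tree {..<card V} ?F"
    using tree_image[OF assms(2), of \<pi>] \<pi> by (auto simp: bij_betw_def)
  have "graph_type V E = graph_type {..<card V} ?F"
    using assms by (intro graph_type_image[OF _ \<pi>, symmetric]) (auto simp: tree_def forest_def)
  also have "\<dots> = (card V, graph_iso {..<card V} `` {?F})"
    using F by (intro graph_type_lessThan) (auto simp: tree_def forest_def)
  finally show ?thesis
    using F by (auto simp: tree_types_def unlabeled_trees_def quotient_def)
qed

lemma component_types_in_weighted_multisets:
  assumes "finite V" "forest V E"
  shows "component_types V E \<in> weighted_multisets tree_types fst (card V)"
  using assms
proof (induction rule: forest_induct)
  case empty
  show ?case by (simp add: component_types_def graph_components_eq weighted_multisets_def)
next
  case (add A E W F)
  hence "component_types (A \<union> W) (E \<union> F) = {#graph_type A E#} + component_types W F"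
    by (simp add: component_types_Un component_types_connected tree_def forest_def)
  thus ?case
    using add graph_type_tree_in_tree_types[of A E]
    by (auto simp: weighted_multisets_def card_Un_disjoint graph_type_def)
qed

text \<open>
  The trees of the multiset are placed one after the other on consecutive intervals of vertices.
\<close>

lemma ex_forest_with_component_types:
  assumes "M \<in> weighted_multisets tree_types fst n"
  shows "\<exists>E. forest {..<n} E \<and> component_types {..<n} E = M"
  using assms
proof (induction M arbitrary: n)
  case empty
  hence "n = 0" by (simp add: weighted_multisets_def)
  moreover have "forest {} ({} :: nat set set)"
    by (auto simp: forest_def simple_graph_def graph_cycle_def intro!: exI[of _ 0])
  ultimately show ?case
    by (intro exI[of _ "{}"]) (simp add: component_types_def graph_components_eq)
next
  case (add x M)
  obtain d C where x: "x = (d, C)" by force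
  have C: "C \<in> unlabeled_trees d" using add.prems by (auto simp: weighted_multisets_def tree_types_def x)
  then obtain T where T: "tree {..<d} T" "C = graph_iso {..<d} `` {T}"
    by (auto simp: unlabeled_trees_def quotient_def)
  define m where "m = (\<Sum>s\<in>#M. fst s)"
  have n: "n = m + d" using add.prems by (simp add: weighted_multisets_def m_def x)
  have "M \<in> weighted_multisets tree_types fst m"
    using add.prems by (auto simp: weighted_multisets_def m_def)
  then obtain E where E: "forest {..<m} E" "component_types {..<m} E = M" using add.IH by blast
  let ?\<pi> = "\<lambda>i. i + m" and ?A = "{m..<n}"
  have img: "?\<pi> ` {..<d} = ?A"
    by (simp add: n lessThan_atLeast0 image_add_atLeastLessThan' add.commute)
  have bij: "bij_betw ?\<pi> {..<d} ?A" unfolding img[symmetric] by (intro inj_on_imp_bij_betw) simp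
  have tree: "tree ?A (graph_image ?\<pi> T)"
    using tree_image[OF T(1), of ?\<pi>] by (simp add: img)
  have simple: "simple_graph {..<d} T" using T(1) by (simp add: tree_def forest_def)
  have "{..<n} = ?A \<union> {..<m}" using n by auto
  moreover have disj: "?A \<inter> {..<m} = {}" by auto
  moreover have "component_types (?A \<union> {..<m}) (graph_image ?\<pi> T \<union> E) = {#graph_type ?A (graph_image ?\<pi> T)#} + M"
    using tree E disj by (simp add: component_types_Un component_types_connected tree_def forest_def)
  moreover have "graph_type ?A (graph_image ?\<pi> T) = x"
    using graph_type_image[OF simple bij] by (simp add: graph_type_lessThan[OF simple] x T(2))
  moreover have "forest (?A \<union> {..<m}) (graph_image ?\<pi> T \<union> E)"
    using tree E disj by (intro forest_Un) (auto simp: tree_def)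
  ultimately show ?case by (intro exI[of _ "graph_image ?\<pi> T \<union> E"]) simp
qed

text \<open>
  Unlabeled forests are multisets of unlabeled trees. The bijection sends a class to the component
  types of any representative.
\<close>

lemma unlabeled_forests_bij_weighted_multisets:
  obtains h where "bij_betw h (unlabeled_forests n) (weighted_multisets tree_types fst n)"
    "\<And>C. C \<in> unlabeled_forests n \<Longrightarrow> size (h C) = num_trees n C"
proof -
  let ?V = "{..<n}"
  define h where "h = (\<lambda>C. component_types ?V (SOME E. E \<in> C))"
  have h: "h (graph_iso ?V `` {E}) = component_types ?V E" if E: "forest ?V E" for E
  proof -
    have cls: "graph_iso ?V `` {E} = {graph_image \<pi> E |\<pi>. bij_betw \<pi> ?V ?V}"
      using E by (intro graph_iso_class) (simp add: forest_def)
    have "E \<in> graph_iso ?V `` {E}"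
      using E by (auto simp: graph_iso_def forest_def intro!: exI[of _ id])
    hence "(SOME F. F \<in> graph_iso ?V `` {E}) \<in> graph_iso ?V `` {E}" by (rule someI)
    then obtain \<pi> where \<pi>: "bij_betw \<pi> ?V ?V" "(SOME F. F \<in> graph_iso ?V `` {E}) = graph_image \<pi> E"
      unfolding cls by blast
    show ?thesis
      using component_types_image[OF _ E, of \<pi>] \<pi> by (simp add: h_def bij_betw_def)
  qed
  have representative: "\<exists>E. forest ?V E \<and> C = graph_iso ?V `` {E}" if "C \<in> unlabeled_forests n" for C
    using that by (auto simp: unlabeled_forests_def quotient_def)
  have "bij_betw h (unlabeled_forests n) (weighted_multisets tree_types fst n)"
  proof (rule bij_betw_imageI)
    show "inj_on h (unlabeled_forests n)"
    proof (rule inj_onI)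
      fix C D assume CD: "C \<in> unlabeled_forests n" "D \<in> unlabeled_forests n" "h C = h D"
      obtain E F where EF: "forest ?V E" "C = graph_iso ?V `` {E}" "forest ?V F" "D = graph_iso ?V `` {F}"
        using representative[OF CD(1)] representative[OF CD(2)] by blast
      obtain \<pi> where "bij_betw \<pi> ?V ?V" "F = graph_image \<pi> E"
        using isomorphic_if_component_types_eq[of ?V E ?V F] EF CD(3) by (auto simp: h)
      hence "(E, F) \<in> graph_iso ?V"
        using EF by (auto simp: graph_iso_def forest_def graph_image_def)
      thus "C = D" unfolding EF by (rule equiv_class_eq[OF equiv_graph_iso])
    qed
    show "h ` unlabeled_forests n = weighted_multisets tree_types fst n"
    proof (intro equalityI subsetI)
      fix M assume "M \<in> h ` unlabeled_forests n"
      thus "M \<in> weighted_multisets tree_types fst n"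
        using representative component_types_in_weighted_multisets[of ?V] by (force simp: h)
    next
      fix M assume "M \<in> weighted_multisets tree_types fst n"
      then obtain E where E: "forest ?V E" "component_types ?V E = M"
        using ex_forest_with_component_types by blast
      hence "graph_iso ?V `` {E} \<in> unlabeled_forests n"
        by (auto simp: unlabeled_forests_def quotient_def)
      thus "M \<in> h ` unlabeled_forests n" by (rule rev_image_eqI) (simp add: h[OF E(1)] E(2))
    qed
  qed
  moreover have "size (h C) = num_trees n C" if C: "C \<in> unlabeled_forests n" for C
  proof -
    obtain E where E: "forest ?V E" "C = graph_iso ?V `` {E}" using representative[OF C] by blast
    have "E \<in> C" using E by (auto simp: graph_iso_def forest_def intro!: exI[of _ id])
    thus ?thesis using num_trees_eq[OF C] E h by (simp add: component_types_def)
  qed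
  ultimately show ?thesis using that by blast
qed

lemma unlabeled_trees_0: "unlabeled_trees 0 = {}"
  by (simp add: unlabeled_trees_def tree_def connected_graph_def)

lemma tree_types_weight:
  "{s\<in>tree_types. fst s = d} = Pair d ` unlabeled_trees d"
  by (auto simp: tree_types_def)

lemma finite_unlabeled_trees: "finite (unlabeled_trees n)"
proof -
  have "unlabeled_trees n \<subseteq> unlabeled_forests n"
    by (auto simp: unlabeled_trees_def unlabeled_forests_def quotient_def tree_def)
  thus ?thesis using finite_unlabeled_forests finite_subset by blast
qed

interpretation tree_types: weighted_types tree_types fst
proof
  show "finite {s \<in> tree_types. fst s = d}" for d
    by (simp add: tree_types_weight finite_unlabeled_trees)
  show "1 \<le> fst s" if "s \<in> tree_types" for s
    using that unlabeled_trees_0 by (cases "fst s") (auto simp: tree_types_def)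
qed

lemma card_tree_types_weight: "card {s\<in>tree_types. fst s = d} = tree_count d"
  by (simp add: tree_types_weight card_image inj_on_def tree_count_def)

text \<open>
  The star with center \<open>0\<close> is a tree: all its edges contain \<open>0\<close>, but a vertex lies on only two of the
  at least three edges of a cycle.
\<close>

lemma tree_count_pos:
  assumes "n \<ge> 1"
  shows "tree_count n \<ge> 1"
proof -
  let ?V = "{..<n}"
  define E where "E = (\<lambda>i. {0, i}) ` {1..<n}"
  have simple: "simple_graph ?V E" using assms by (auto simp: simple_graph_def E_def)
  have zero: "0 \<in> {x, y}" if "{x, y} \<in> E" for x y
    using that unfolding E_def by blast
  have "\<not> graph_cycle E vs" for vs
  proof
    assume cyc: "graph_cycle E vs"
    let ?l = "length vs"
    have l: "?l \<ge> 3" "distinct vs" using cyc by (auto simp: graph_cycle_def)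
    have z: "vs ! i = 0 \<or> vs ! (Suc i mod ?l) = 0" if "i < ?l" for i
      using cyc that zero[of "vs ! i" "vs ! (Suc i mod ?l)"] by (auto simp: graph_cycle_def)
    have uniq: "i = j" if "vs ! i = 0" "vs ! j = 0" "i < ?l" "j < ?l" for i j
      using nth_eq_iff_index_eq[OF l(2) that(3,4)] that(1,2) by simp
    have "vs \<noteq> []" using l by auto
    hence z012: "vs ! 0 = 0 \<or> vs ! 1 = 0" "vs ! 1 = 0 \<or> vs ! 2 = 0"
        "vs ! 2 = 0 \<or> vs ! (3 mod ?l) = 0"
      using z[of 0] z[of 1] z[of 2] l by (simp_all add: numeral_3_eq_3 numeral_2_eq_2)
    show False
    proof (cases "vs ! 1 = 0")
      case True
      hence "vs ! 2 \<noteq> 0" using uniq[of 1 2] l by auto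
      hence "vs ! (3 mod ?l) = 0" using z012 by simp
      moreover have "3 mod ?l < ?l" using l by (intro mod_less_divisor) auto
      ultimately have "1 = 3 mod ?l" using uniq[of 1 "3 mod ?l"] True l by auto
      thus False using l by (cases "?l = 3") auto
    next
      case False
      thus False using z012 uniq[of 0 2] l \<open>vs \<noteq> []\<close> by auto
    qed
  qed
  hence "forest ?V E" using simple by (simp add: forest_def)
  moreover have "connected_graph ?V E"
    unfolding connected_graph_def
  proof (intro conjI ballI)
    have *: "(0, u) \<in> (adj E)\<^sup>*" if "u \<in> ?V" for u
      using that by (cases "u = 0") (auto simp: adj_def E_def intro!: r_into_rtrancl)
    show "(u, v) \<in> (adj E)\<^sup>*" if "u \<in> ?V" "v \<in> ?V" for u v
      using reachable_sym[OF *[OF that(1)]] *[OF that(2)] by (rule rtrancl_trans)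
  qed (use simple assms in \<open>auto simp: lessThan_empty_iff\<close>)
  ultimately have "graph_iso ?V `` {E} \<in> unlabeled_trees n"
    by (auto simp: unlabeled_trees_def tree_def quotient_def)
  thus ?thesis
    using finite_unlabeled_trees card_gt_0_iff by (fastforce simp: tree_count_def Suc_le_eq)
qed

section \<open>Consequences of Otter's asymptotics\<close>

definition forest_gf :: "real \<Rightarrow> nat \<Rightarrow> real" where
  "forest_gf z n = (\<Sum>C\<in>unlabeled_forests n. z ^ num_trees n C)"

text \<open>
  The coefficient of \<open>x ^ m\<close> in \<open>\<Sum>k\<ge>1. z ^ k / k * t ((\<alpha> * x) ^ k)\<close>, where \<open>t\<close> is the generating function
  of trees and \<open>m = k * d\<close> for a tree with \<open>d\<close> vertices.
\<close>

definition power_sum_coeff :: "real \<Rightarrow> real \<Rightarrow> nat \<Rightarrow> real" where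
  "power_sum_coeff \<alpha> z m =
     (\<Sum>d | d \<in> {1..m} \<and> d dvd m. real (tree_count d) * \<alpha> ^ m * z ^ (m div d) / real (m div d))"

lemma forest_gf_eq_multiset_gf: "forest_gf z n = multiset_gf tree_types fst z n"
proof -
  obtain h where h: "bij_betw h (unlabeled_forests n) (weighted_multisets tree_types fst n)"
    "\<And>C. C \<in> unlabeled_forests n \<Longrightarrow> size (h C) = num_trees n C"
    using unlabeled_forests_bij_weighted_multisets[of n] by blast
  show ?thesis
    unfolding multiset_gf_def forest_gf_def sum.reindex_bij_betw[OF h(1), symmetric]
    by (intro sum.cong) (simp_all add: h(2))
qed

lemma num_trees_pos:
  assumes "C \<in> unlabeled_forests n" "n \<ge> 1"
  shows "num_trees n C \<ge> 1"
proof -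
  obtain h where h: "bij_betw h (unlabeled_forests n) (weighted_multisets tree_types fst n)"
    "\<And>C. C \<in> unlabeled_forests n \<Longrightarrow> size (h C) = num_trees n C"
    using unlabeled_forests_bij_weighted_multisets[of n] by blast
  have "h C \<in> weighted_multisets tree_types fst n"
    using h(1) assms(1) by (auto simp: bij_betw_def)
  hence "h C \<noteq> {#}" using assms(2) by (auto simp: weighted_multisets_def)
  thus ?thesis using h(2)[OF assms(1)] by (simp add: Suc_le_eq flip: h(2)[OF assms(1)] nonempty_has_size)
qed

text \<open>
  This is the identity \<open>\<Sum>n. forest_gf z n * x ^ n = exp (\<Sum>k\<ge>1. z ^ k / k * t (x ^ k))\<close>,
  with \<open>\<alpha> * x\<close> substituted for \<open>x\<close>.
\<close>

lemma exp_recurrence_forest_gf: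
  assumes "\<alpha> > 0" "z \<ge> 0"
  shows "exp_recurrence (power_sum_coeff \<alpha> z) (\<lambda>n. \<alpha> ^ n * forest_gf z n)"
proof
  show "power_sum_coeff \<alpha> z 0 = 0" by (simp add: power_sum_coeff_def)
  show "power_sum_coeff \<alpha> z m \<ge> 0" for m
    using assms by (auto simp: power_sum_coeff_def intro!: sum_nonneg)
  show "\<alpha> ^ 0 * forest_gf z 0 = 1"
    by (simp add: forest_gf_eq_multiset_gf tree_types.multiset_gf_0)
next
  fix n
  let ?D = "\<lambda>m. {d. d \<in> {1..m} \<and> d dvd m}"
  have coeff: "real m * power_sum_coeff \<alpha> z m =
      \<alpha> ^ m * (\<Sum>d\<in>?D m. real d * real (tree_count d) * z ^ (m div d))" for m
    unfolding power_sum_coeff_def sum_distrib_left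
  proof (rule sum.cong[OF refl])
    fix d assume d: "d \<in> ?D m"
    then obtain k where k: "m = d * k" by (auto elim: dvdE)
    thus "real m * (real (tree_count d) * \<alpha> ^ m * z ^ (m div d) / real (m div d)) =
        \<alpha> ^ m * (real d * real (tree_count d) * z ^ (m div d))"
      using d by auto
  qed
  have "real n * (\<alpha> ^ n * forest_gf z n) = \<alpha> ^ n * (real n * multiset_gf tree_types fst z n)"
    by (simp add: forest_gf_eq_multiset_gf)
  also have "\<dots> = (\<Sum>i<n. \<alpha> ^ n * ((\<Sum>d\<in>?D (n - i).
      real d * real (tree_count d) * z ^ ((n - i) div d)) * forest_gf z i))"
    unfolding tree_types.multiset_gf_rec card_tree_types_weight
    by (simp add: sum_distrib_left forest_gf_eq_multiset_gf)
  also have "\<dots> = (\<Sum>i<n. real (n - i) * power_sum_coeff \<alpha> z (n - i) * (\<alpha> ^ i * forest_gf z i))"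
  proof (rule sum.cong[OF refl])
    fix i assume "i \<in> {..<n}"
    hence "\<alpha> ^ n = \<alpha> ^ (n - i) * \<alpha> ^ i" by (simp flip: power_add)
    thus "\<alpha> ^ n * ((\<Sum>d\<in>?D (n - i). real d * real (tree_count d) * z ^ ((n - i) div d)) * forest_gf z i) =
        real (n - i) * power_sum_coeff \<alpha> z (n - i) * (\<alpha> ^ i * forest_gf z i)"
      unfolding coeff by simp
  qed
  finally show "real n * (\<alpha> ^ n * forest_gf z n) =
      (\<Sum>i<n. real (n - i) * power_sum_coeff \<alpha> z (n - i) * (\<alpha> ^ i * forest_gf z i))" .
qed

locale otter_asymptotics =
  fixes \<alpha> \<beta> :: real
  assumes \<alpha>_pos: "\<alpha> > 0" and \<beta>_pos: "\<beta> > 0"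
    and otter: "(\<lambda>n. \<alpha> ^ n * real n powr (5/2) * real (tree_count n)) \<longlonglongrightarrow> \<beta>"
begin

text \<open>
  Since there is at least one tree of every size, \<open>\<alpha> \<ge> 1\<close> would force \<open>\<alpha> ^ n * n powr (5/2) * t\<^sub>n\<close> to diverge.
\<close>

lemma \<alpha>_less_1: "\<alpha> < 1"
proof (rule ccontr)
  assume "\<not> \<alpha> < 1"
  have "filterlim (\<lambda>n. \<alpha> ^ n * real n powr (5/2) * real (tree_count n)) at_top sequentially"
  proof (rule filterlim_at_top_mono)
    show "filterlim (\<lambda>n. real n powr (5/2)) at_top sequentially" by real_asymp
    show "eventually (\<lambda>n. real n powr (5/2) \<le> \<alpha> ^ n * real n powr (5/2) * real (tree_count n)) sequentially"
      using eventually_ge_at_top[of 1]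
    proof eventually_elim
      case (elim n)
      have "1 * real n powr (5/2) * 1 \<le> \<alpha> ^ n * real n powr (5/2) * real (tree_count n)"
        using tree_count_pos[OF elim] \<open>\<not> \<alpha> < 1\<close> by (intro mult_mono one_le_power) auto
      thus ?case by simp
    qed
  qed
  thus False
    using otter not_tendsto_and_filterlim_at_infinity[OF _ otter] filterlim_at_top_imp_at_infinity
    by auto
qed

lemma tree_count_bounded:
  obtains A where "A \<ge> 0" "\<And>d. d \<ge> 1 \<Longrightarrow> real (tree_count d) * \<alpha> ^ d \<le> A"
proof -
  obtain A where "A > 0" "\<forall>n. norm (\<alpha> ^ n * real n powr (5/2) * real (tree_count n)) \<le> A"
    using convergent_imp_Bseq[OF convergentI[OF otter]] by (auto simp: Bseq_def)
  hence A: "\<alpha> ^ n * real n powr (5/2) * real (tree_count n) \<le> A" for n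
    using abs_le_D1 real_norm_def by metis
  have "real (tree_count d) * \<alpha> ^ d \<le> A" if "d \<ge> 1" for d
  proof -
    have "real (tree_count d) * \<alpha> ^ d * 1 \<le> real (tree_count d) * \<alpha> ^ d * real d powr (5/2)"
      using that \<alpha>_pos by (intro mult_left_mono ge_one_powr_ge_zero) auto
    thus ?thesis using A[of d] by (simp add: mult_ac)
  qed
  thus ?thesis using that \<open>A > 0\<close> by (meson less_imp_le)
qed

text \<open>
  The divisor \<open>d = m\<close> (that is, \<open>k = 1\<close>) contributes Otter's asymptotics. All other divisors satisfy
  \<open>d \<le> m div 2\<close>, and their contribution is exponentially small because of the factor \<open>\<alpha> ^ (m - d)\<close>.
  The bound on \<open>z\<close> is chosen such that values slightly above \<open>1\<close> are covered and \<open>z ^ k\<close> cannot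
  outweigh this factor.
\<close>

lemma power_sum_coeff_asymptotics:
  assumes z: "0 < z" "z ^ 4 * \<alpha> \<le> 1"
  shows "(\<lambda>m. power_sum_coeff \<alpha> z m * real m powr (5/2)) \<longlonglongrightarrow> \<beta> * z"
proof -
  obtain A where A: "A \<ge> 0" "\<And>d. d \<ge> 1 \<Longrightarrow> real (tree_count d) * \<alpha> ^ d \<le> A"
    using tree_count_bounded by blast
  \<comment> \<open>For \<open>d * k = m\<close> with \<open>k \<ge> 2\<close>, the exponents satisfy \<open>m + k \<le> 4 * (m - d)\<close>. As \<open>z * q \<le> 1\<close> for the
    fourth root \<open>q\<close> of \<open>\<alpha>\<close>, this gives \<open>\<alpha> ^ (m - d) * z ^ k \<le> q ^ m\<close>.\<close>
  obtain q where q: "q > 0" "q < 1" "\<alpha> = q ^ 4"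
    using \<alpha>_pos \<alpha>_less_1 by (intro that[of "root 4 \<alpha>"]) simp_all
  have "(z * q) ^ 4 \<le> 1" using z(2) q(3) by (simp add: power_mult_distrib)
  hence zq: "z * q \<le> 1" using power_le_one_iff[of "z * q" 4] z(1) q(1) by auto
  define r where "r = (\<lambda>m. \<Sum>d | d \<in> {1..<m} \<and> d dvd m.
    real (tree_count d) * \<alpha> ^ m * z ^ (m div d) / real (m div d))"
  have split: "power_sum_coeff \<alpha> z m = z * (\<alpha> ^ m * real (tree_count m)) + r m" if "m \<ge> 1" for m
  proof -
    have "{d. d \<in> {1..m} \<and> d dvd m} = insert m {d. d \<in> {1..<m} \<and> d dvd m}" using that by auto
    thus ?thesis using that by (simp add: power_sum_coeff_def r_def)
  qed
  have term_le: "real (tree_count d) * \<alpha> ^ m * z ^ (m div d) / real (m div d) \<le> A * q ^ m"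
    if d: "d \<in> {1..<m}" "d dvd m" for m d
  proof -
    obtain k where k: "m = d * k" using d by (auto elim: dvdE)
    have "k \<ge> 2"
    proof (rule ccontr)
      assume "\<not> k \<ge> 2"
      hence "k = 0 \<or> k = 1" by auto
      thus False using d k by auto
    qed
    have "d * 2 \<le> m" "1 * k \<le> m" unfolding k using \<open>k \<ge> 2\<close> d by (intro mult_le_mono; simp)+
    hence exps: "m + k \<le> 4 * (m - d)" by linarith
    have "q ^ (4 * (m - d)) * z ^ k \<le> q ^ (m + k) * z ^ k"
      using exps q z by (intro mult_right_mono power_decreasing) auto
    also have "\<dots> = q ^ m * (z * q) ^ k" by (simp add: power_add power_mult_distrib)
    also have "\<dots> \<le> q ^ m * 1" using q z zq by (intro mult_left_mono power_le_one) auto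
    finally have *: "q ^ (4 * (m - d)) * z ^ k \<le> q ^ m" by simp
    have "\<alpha> ^ m = \<alpha> ^ d * \<alpha> ^ (m - d)" using d by (simp flip: power_add)
    hence "real (tree_count d) * \<alpha> ^ m * z ^ k = (real (tree_count d) * \<alpha> ^ d) * (q ^ (4 * (m - d)) * z ^ k)"
      by (simp add: power_mult flip: q(3))
    also have "\<dots> \<le> A * q ^ m"
      using A(2)[of d] d A(1) q z by (intro mult_mono *) auto
    finally have "real (tree_count d) * \<alpha> ^ m * z ^ k \<le> A * q ^ m" .
    moreover have "real (tree_count d) * \<alpha> ^ m * z ^ k / real k \<le> real (tree_count d) * \<alpha> ^ m * z ^ k / 1"
      using \<open>k \<ge> 2\<close> \<alpha>_pos z by (intro divide_left_mono) auto
    ultimately show ?thesis using k d by auto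
  qed
  have r_le: "r m \<le> real m * (A * q ^ m)" for m
  proof -
    have "r m \<le> (\<Sum>d | d \<in> {1..<m} \<and> d dvd m. A * q ^ m)"
      unfolding r_def by (intro sum_mono term_le) auto
    also have "\<dots> = real (card {d. d \<in> {1..<m} \<and> d dvd m}) * (A * q ^ m)" by simp
    also have "\<dots> \<le> real (card {1..<m}) * (A * q ^ m)"
      using A q by (intro mult_right_mono of_nat_mono card_mono) auto
    also have "\<dots> \<le> real m * (A * q ^ m)" using A q by (intro mult_right_mono) auto
    finally show ?thesis .
  qed
  have r_nonneg: "r m \<ge> 0" for m unfolding r_def using z \<alpha>_pos by (intro sum_nonneg) auto
  have "(\<lambda>m. real m * (A * q ^ m) * real m powr (5/2)) \<longlonglongrightarrow> 0"
    using q by real_asymp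
  hence "(\<lambda>m. r m * real m powr (5/2)) \<longlonglongrightarrow> 0"
    by (rule tendsto_sandwich[OF _ _ tendsto_const, rotated 2])
       (simp_all add: r_le r_nonneg mult_right_mono)
  hence "(\<lambda>m. z * (\<alpha> ^ m * real m powr (5/2) * real (tree_count m)) + r m * real m powr (5/2)) \<longlonglongrightarrow> z * \<beta> + 0"
    by (intro tendsto_intros otter)
  moreover have "eventually (\<lambda>m. z * (\<alpha> ^ m * real m powr (5/2) * real (tree_count m)) + r m * real m powr (5/2)
      = power_sum_coeff \<alpha> z m * real m powr (5/2)) sequentially"
    using eventually_ge_at_top[of 1] by eventually_elim (simp add: split algebra_simps)
  ultimately show ?thesis by (simp add: tendsto_cong mult.commute)
qed

lemma tree_gf_has_sum:
  assumes "k \<ge> 1"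
  shows "((\<lambda>d. real (tree_count d) * (\<alpha> ^ k) ^ d) has_sum tree_gf (\<alpha> ^ k)) {1..}"
    and "tree_gf (\<alpha> ^ k) \<le> \<alpha> ^ (k - 1) * tree_gf \<alpha>"
    and "tree_gf (\<alpha> ^ k) \<ge> 0"
proof -
  have coeff_1: "real (tree_count m) * \<alpha> ^ m \<le> power_sum_coeff \<alpha> 1 m" if "m \<ge> 1" for m
  proof -
    have "real (tree_count m) * \<alpha> ^ m = real (tree_count m) * \<alpha> ^ m * 1 ^ (m div m) / real (m div m)"
      using that by simp
    also have "\<dots> \<le> power_sum_coeff \<alpha> 1 m"
      unfolding power_sum_coeff_def using that \<alpha>_pos by (intro member_le_sum) auto
    finally show ?thesis .
  qed
  interpret exp_recurrence "power_sum_coeff \<alpha> 1" "\<lambda>n. \<alpha> ^ n * forest_gf 1 n"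
    by (rule exp_recurrence_forest_gf) (use \<alpha>_pos in auto)
  have "summable (power_sum_coeff \<alpha> 1)"
    by (rule regular_variation(1)[OF _ power_sum_coeff_asymptotics]) (use \<alpha>_less_1 in auto)
  hence "summable (\<lambda>n. power_sum_coeff \<alpha> 1 (Suc n))" by (simp only: summable_Suc_iff)
  hence sum1: "summable (\<lambda>n. real (tree_count (Suc n)) * \<alpha> ^ Suc n)"
  proof (rule summable_comparison_test'[of _ 0])
    show "norm (real (tree_count (Suc n)) * \<alpha> ^ Suc n) \<le> power_sum_coeff \<alpha> 1 (Suc n)" for n
      using coeff_1[of "Suc n"] \<alpha>_pos by (simp add: abs_mult)
  qed
  have le: "(\<alpha> ^ k) ^ Suc n \<le> \<alpha> ^ (k - 1) * \<alpha> ^ Suc n" for n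
  proof -
    have "k - 1 + Suc n \<le> k * Suc n" using assms by (cases k) auto
    hence "\<alpha> ^ (k * Suc n) \<le> \<alpha> ^ (k - 1 + Suc n)"
      using \<alpha>_pos \<alpha>_less_1 by (intro power_decreasing) auto
    thus ?thesis by (simp only: power_mult power_add)
  qed
  have le': "real (tree_count (Suc n)) * (\<alpha> ^ k) ^ Suc n
      \<le> \<alpha> ^ (k - 1) * (real (tree_count (Suc n)) * \<alpha> ^ Suc n)" for n
    using mult_left_mono[OF le[of n], of "real (tree_count (Suc n))"] by (simp only: mult.left_commute)
  have nonneg: "real (tree_count (Suc n)) * (\<alpha> ^ k) ^ Suc n \<ge> 0" for n using \<alpha>_pos by simp
  have sum: "summable (\<lambda>n. real (tree_count (Suc n)) * (\<alpha> ^ k) ^ Suc n)"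
  proof (rule summable_comparison_test'[OF summable_mult[OF sum1, of "\<alpha> ^ (k - 1)"], of 0])
    show "norm (real (tree_count (Suc n)) * (\<alpha> ^ k) ^ Suc n) \<le> \<alpha> ^ (k - 1) * (real (tree_count (Suc n)) * \<alpha> ^ Suc n)" for n
      unfolding real_norm_def abs_of_nonneg[OF nonneg] by (rule le')
  qed
  have "(\<lambda>n. real (tree_count (Suc n)) * (\<alpha> ^ k) ^ Suc n) sums tree_gf (\<alpha> ^ k)"
    unfolding tree_gf_def using sum by (rule summable_sums)
  hence "((\<lambda>n. real (tree_count (Suc n)) * (\<alpha> ^ k) ^ Suc n) has_sum tree_gf (\<alpha> ^ k)) UNIV"
    using \<alpha>_pos by (intro sums_nonneg_imp_has_sum) auto
  moreover have "bij_betw Suc UNIV {1..}"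
    by (rule bij_betwI[where g = "\<lambda>k. k - 1"]) auto
  ultimately show "((\<lambda>d. real (tree_count d) * (\<alpha> ^ k) ^ d) has_sum tree_gf (\<alpha> ^ k)) {1..}"
    using has_sum_reindex_bij_betw[of Suc UNIV "{1..}"] by fastforce
  show "tree_gf (\<alpha> ^ k) \<le> \<alpha> ^ (k - 1) * tree_gf \<alpha>"
    unfolding tree_gf_def
    by (subst suminf_mult[OF sum1, symmetric], rule suminf_le[OF le' sum summable_mult[OF sum1]])
  show "tree_gf (\<alpha> ^ k) \<ge> 0"
    unfolding tree_gf_def using \<alpha>_pos by (intro suminf_nonneg sum) auto
qed

text \<open>
  Both sides sum \<open>t\<^sub>d * \<alpha> ^ (k * d) * z ^ k / k\<close> over all \<open>k\<close> and \<open>d\<close>, grouped by \<open>m = k * d\<close> on the left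
  and by \<open>k\<close> on the right.
\<close>

lemma power_sum_coeff_sums:
  assumes z: "0 \<le> z" "z \<le> 1"
  shows "(\<Sum>m. power_sum_coeff \<alpha> z m) = (\<Sum>k. tree_gf (\<alpha> ^ Suc k) / real (Suc k) * z ^ Suc k)"
    and "summable (\<lambda>k. tree_gf (\<alpha> ^ Suc k) / real (Suc k) * z ^ Suc k)"
proof -
  define h where "h = (\<lambda>(k,d). real (tree_count d) * (\<alpha> ^ k) ^ d * (z ^ k / real k))"
  define G where "G = (\<lambda>k. tree_gf (\<alpha> ^ k) / real k * z ^ k)"
  have h_nonneg: "h x \<ge> 0" for x using \<alpha>_pos z by (auto simp: h_def case_prod_unfold)
  have row: "((\<lambda>d. h (k, d)) has_sum G k) {1..}" if "k \<ge> 1" for k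
    using has_sum_cmult_left[OF tree_gf_has_sum(1)[OF that], of "z ^ k / real k"]
    by (simp add: h_def G_def)
  have G_nonneg: "G k \<ge> 0" if "k \<ge> 1" for k
    using tree_gf_has_sum(3)[OF that] z by (simp add: G_def)
  have G_le: "G (Suc k) \<le> tree_gf \<alpha> * \<alpha> ^ k" for k
  proof -
    have "tree_gf (\<alpha> ^ Suc k) / real (Suc k) * z ^ Suc k \<le> tree_gf (\<alpha> ^ Suc k) / 1 * 1"
      using tree_gf_has_sum(3)[of "Suc k"] z
      by (intro mult_mono divide_left_mono power_le_one) auto
    thus ?thesis using tree_gf_has_sum(2)[of "Suc k"] by (simp add: G_def mult.commute)
  qed
  have "summable (\<lambda>k. tree_gf \<alpha> * \<alpha> ^ k)"
    using \<alpha>_pos \<alpha>_less_1 by (intro summable_mult summable_geometric) auto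
  hence G_sum: "summable (\<lambda>k. G (Suc k))"
    by (rule summable_comparison_test'[of _ 0]) (simp add: G_le G_nonneg)
  thus "summable (\<lambda>k. tree_gf (\<alpha> ^ Suc k) / real (Suc k) * z ^ Suc k)" by (simp add: G_def)
  have bij: "bij_betw Suc UNIV {1..}"
    by (rule bij_betwI[where g = "\<lambda>k. k - 1"]) auto
  have "((\<lambda>k. G (Suc k)) has_sum (\<Sum>k. G (Suc k))) UNIV"
    using G_sum G_nonneg by (intro sums_nonneg_imp_has_sum summable_sums) auto
  hence G_has: "(G has_sum (\<Sum>k. G (Suc k))) {1..}"
    using has_sum_reindex_bij_betw[OF bij, of G] by simp
  have h_has: "(h has_sum (\<Sum>k. G (Suc k))) ({1..} \<times> {1..})"
    using row G_has h_nonneg by (intro has_sum_SigmaI[where g = G] summable_on_SigmaI[where g = G])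
      (auto simp: has_sum_imp_summable)
  define D where "D = (\<lambda>m::nat. {d. d \<in> {1..m} \<and> d dvd m})"
  have "((\<lambda>(m,d). h (m div d, d)) has_sum (\<Sum>k. G (Suc k))) (Sigma {1..} D)"
  proof (subst has_sum_reindex_bij_witness[where i = "\<lambda>(k,d). (k * d, d)" and j = "\<lambda>(m,d). (m div d, d)"
        and T = "{1..} \<times> {1..}" and h = h and s' = "\<Sum>k. G (Suc k)"])
    show "(h has_sum (\<Sum>k. G (Suc k))) ({1..} \<times> {1..})" by (rule h_has)
  qed (auto simp: D_def Suc_le_eq elim!: dvdE)
  moreover have "((\<lambda>d. (\<lambda>(m,d). h (m div d, d)) (m, d)) has_sum power_sum_coeff \<alpha> z m) (D m)" if "m \<in> {1..}" for m
  proof -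
    have "finite (D m)" by (simp add: D_def)
    moreover have "(\<Sum>d\<in>D m. h (m div d, d)) = power_sum_coeff \<alpha> z m"
      unfolding power_sum_coeff_def D_def
      by (intro sum.cong refl) (auto simp: h_def simp flip: power_mult)
    ultimately show ?thesis by (simp add: has_sum_finiteI)
  qed
  ultimately have "(power_sum_coeff \<alpha> z has_sum (\<Sum>k. G (Suc k))) {1..}"
    by (rule has_sum_SigmaD)
  hence "(power_sum_coeff \<alpha> z has_sum (\<Sum>k. G (Suc k))) UNIV"
    by (rule has_sum_cong_neutral[THEN iffD1, rotated -1]) (auto simp: power_sum_coeff_def not_le)
  hence "power_sum_coeff \<alpha> z sums (\<Sum>k. G (Suc k))" by (rule has_sum_imp_sums)
  thus "(\<Sum>m. power_sum_coeff \<alpha> z m) = (\<Sum>k. tree_gf (\<alpha> ^ Suc k) / real (Suc k) * z ^ Suc k)"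
    by (simp add: sums_iff G_def)
qed

lemma forest_gf_ratio_tendsto:
  assumes z: "0 < z" "z ^ 4 * \<alpha> \<le> 1"
  shows "(\<lambda>n. forest_gf z n / forest_gf 1 n) \<longlonglongrightarrow>
           z * exp ((\<Sum>m. power_sum_coeff \<alpha> z m) - (\<Sum>m. power_sum_coeff \<alpha> 1 m))"
proof -
  have *: "(\<lambda>n. (\<alpha> ^ n * forest_gf y n) * real n powr (5/2)) \<longlonglongrightarrow> \<beta> * y * exp (\<Sum>m. power_sum_coeff \<alpha> y m)"
    if "0 < y" "y ^ 4 * \<alpha> \<le> 1" for y
    using that \<alpha>_pos
    by (intro exp_recurrence.regular_variation(2) exp_recurrence_forest_gf power_sum_coeff_asymptotics) auto
  have "(\<lambda>n. ((\<alpha> ^ n * forest_gf z n) * real n powr (5/2)) / ((\<alpha> ^ n * forest_gf 1 n) * real n powr (5/2)))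
      \<longlonglongrightarrow> (\<beta> * z * exp (\<Sum>m. power_sum_coeff \<alpha> z m)) / (\<beta> * 1 * exp (\<Sum>m. power_sum_coeff \<alpha> 1 m))"
    using z \<alpha>_less_1 \<beta>_pos by (intro tendsto_divide *) auto
  moreover have "eventually (\<lambda>n. ((\<alpha> ^ n * forest_gf z n) * real n powr (5/2)) / ((\<alpha> ^ n * forest_gf 1 n) * real n powr (5/2))
      = forest_gf z n / forest_gf 1 n) sequentially"
    using eventually_gt_at_top[of 0] by eventually_elim (use \<alpha>_pos in simp)
  ultimately show ?thesis using \<beta>_pos by (simp add: tendsto_cong exp_diff)
qed

end

section \<open>Convergence in distribution and of moments\<close>

lemma (in prob_space) abs_expectation_diff_le:
  fixes f g :: "'a \<Rightarrow> real"
  assumes "integrable M f" "integrable M g" "AE x in M. \<bar>f x - g x\<bar> \<le> e"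
  shows "\<bar>expectation f - expectation g\<bar> \<le> e"
proof -
  have "\<bar>expectation f - expectation g\<bar> = \<bar>expectation (\<lambda>x. f x - g x)\<bar>"
    using assms by simp
  also have "\<dots> \<le> expectation (\<lambda>x. \<bar>f x - g x\<bar>)" by (rule integral_abs_bound)
  also have "\<dots> \<le> e" using assms by (intro integral_le_const) auto
  finally show ?thesis .
qed

text \<open>
  On a compact interval every continuous function is a uniform limit of polynomials, whose
  expectations converge by assumption.
\<close>

lemma weak_conv_m_if_moments_unit_interval:
  fixes \<mu> :: "nat \<Rightarrow> real measure"
  assumes \<mu>: "\<And>n. real_distribution (\<mu> n)" and M: "real_distribution M"
    and \<mu>_unit: "\<And>n. AE x in \<mu> n. x \<in> {0..1}" and M_unit: "AE x in M. x \<in> {0..1}"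
    and lim: "\<And>k. (\<lambda>n. LINT x|\<mu> n. x ^ k) \<longlonglongrightarrow> (LINT x|M. x ^ k)"
  shows "weak_conv_m \<mu> M"
proof (rule integral_bdd_continuous_conv_imp_weak_conv[OF \<mu> M])
  fix f :: "real \<Rightarrow> real" assume f: "\<And>x. isCont f x" "\<And>x. \<bar>f x\<bar> \<le> 1"
  have [measurable]: "f \<in> borel_measurable borel"
    using f(1) by (intro borel_measurable_continuous_onI continuous_at_imp_continuous_on) auto
  show "(\<lambda>n. LINT x|\<mu> n. f x) \<longlonglongrightarrow> (LINT x|M. f x)"
  proof (rule LIMSEQ_I)
    fix e :: real assume "e > 0"
    have "continuous_on {0..1} f" using f(1) by (intro continuous_at_imp_continuous_on) auto
    then obtain p where p: "real_polynomial_function p" "\<And>x. x \<in> {0..1} \<Longrightarrow> \<bar>f x - p x\<bar> < e / 3"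
      using Stone_Weierstrass_real_polynomial_function[of "{0..1::real}" f "e / 3"] \<open>e > 0\<close> by auto
    obtain a N where p_eq: "p = (\<lambda>x. \<Sum>i\<le>N. a i * x ^ i)"
      using p(1) unfolding real_polynomial_function_iff_sum by blast
    have close: "integrable L p \<and> (LINT x|L. p x) = (\<Sum>i\<le>N. a i * (LINT x|L. x ^ i))
        \<and> \<bar>(LINT x|L. f x) - (LINT x|L. p x)\<bar> \<le> e / 3"
      if L: "real_distribution L" "AE x in L. x \<in> {0..1}" for L
    proof -
      interpret L: real_distribution L by (rule L(1))
      have pow: "integrable L (\<lambda>x. x ^ i)" for i :: nat
        using L(2) by (intro L.integrable_const_bound[where B = 1]) (auto simp: power_le_one)
      have p_int: "integrable L p" unfolding p_eq using pow by auto
      have f_int: "integrable L f" using f(2) by (intro L.integrable_const_bound[where B = 1]) auto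
      have "\<bar>(LINT x|L. f x) - (LINT x|L. p x)\<bar> \<le> e / 3"
        using L(2) p(2) by (intro L.abs_expectation_diff_le f_int p_int) (auto intro: less_imp_le)
      thus ?thesis using p_int pow by (simp add: p_eq)
    qed
    have "(\<lambda>n. LINT x|\<mu> n. p x) \<longlonglongrightarrow> (LINT x|M. p x)"
      using close[OF \<mu> \<mu>_unit] close[OF M M_unit] lim by (auto intro!: tendsto_intros)
    then obtain n0 where n0: "\<And>n. n \<ge> n0 \<Longrightarrow> \<bar>(LINT x|\<mu> n. p x) - (LINT x|M. p x)\<bar> < e / 3"
      using LIMSEQ_D[of _ _ "e / 3"] \<open>e > 0\<close> by (metis real_norm_def divide_pos_pos zero_less_numeral)
    have "norm ((LINT x|\<mu> n. f x) - (LINT x|M. f x)) < e" if "n \<ge> n0" for n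
      using n0[OF that] conjunct2[OF conjunct2[OF close[OF \<mu>[of n] \<mu>_unit[of n]]]]
        conjunct2[OF conjunct2[OF close[OF M M_unit]]] unfolding real_norm_def by linarith
    thus "\<exists>n0. \<forall>n\<ge>n0. norm ((LINT x|\<mu> n. f x) - (LINT x|M. f x)) < e" by blast
  qed
qed

text \<open>
  Convergence of the Laplace transforms at the positive integers is convergence of the moments of
  \<open>Y = exp (- X)\<close>, which lives on the unit interval. The map back, \<open>X = - ln Y\<close>, is discontinuous only
  at \<open>0\<close>, which has probability \<open>0\<close> for the limit of \<open>Y\<close>.
\<close>

lemma weak_conv_m_if_Laplace:
  fixes \<mu> :: "nat \<Rightarrow> real measure"
  assumes \<mu>: "\<And>n. real_distribution (\<mu> n)" and M: "real_distribution M"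
    and \<mu>_nonneg: "\<And>n. AE x in \<mu> n. x \<ge> 0" and M_nonneg: "AE x in M. x \<ge> 0"
    and lim: "\<And>k. k \<ge> 1 \<Longrightarrow> (\<lambda>n. LINT x|\<mu> n. exp (- real k * x)) \<longlonglongrightarrow> (LINT x|M. exp (- real k * x))"
  shows "weak_conv_m \<mu> M"
proof -
  define \<nu> where "\<nu> = (\<lambda>n. distr (\<mu> n) borel (\<lambda>x. exp (- x)))"
  define N where "N = distr M borel (\<lambda>x. exp (- x))"
  have distr: "real_distribution (distr L borel (\<lambda>x. exp (- x)))" if "real_distribution L" for L
  proof -
    interpret L: real_distribution L by (rule that)
    show ?thesis by (intro L.real_distribution_distr) simp
  qed
  have unit: "AE x in distr L borel (\<lambda>x. exp (- x)). x \<in> {0..1}"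
    if "real_distribution L" "AE x in L. x \<ge> 0" for L
  proof -
    interpret L: real_distribution L by (rule that)
    show ?thesis using that(2) by (subst AE_distr_iff) auto
  qed
  have int: "(LINT x|distr L borel (\<lambda>x. exp (- x)). f x) = (LINT x|L. f (exp (- x)))"
    if "real_distribution L" "f \<in> borel_measurable borel" for L and f :: "real \<Rightarrow> real"
  proof -
    interpret L: real_distribution L by (rule that)
    show ?thesis using that(2) by (intro integral_distr) auto
  qed
  have \<nu>: "real_distribution (\<nu> n)" and N: "real_distribution N" for n
    unfolding \<nu>_def N_def by (intro distr \<mu> M)+
  have wc: "weak_conv_m \<nu> N"
  proof (rule weak_conv_m_if_moments_unit_interval[OF \<nu> N])
    show "AE x in \<nu> n. x \<in> {0..1}" for n unfolding \<nu>_def by (rule unit[OF \<mu> \<mu>_nonneg])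
    show "AE x in N. x \<in> {0..1}" unfolding N_def by (rule unit[OF M M_nonneg])
  next
    fix k
    show "(\<lambda>n. LINT x|\<nu> n. x ^ k) \<longlonglongrightarrow> (LINT x|N. x ^ k)"
    proof (cases "k = 0")
      case True
      have "(LINT x|\<nu> n. x ^ k) = 1" "(LINT x|N. x ^ k) = 1" for n
        using \<nu> N True by (simp_all add: real_distribution_def prob_space.prob_space)
      thus ?thesis by simp
    next
      case False
      have "(LINT x|L. exp (- x) ^ k) = (LINT x|L. exp (- real k * x))" for L :: "real measure"
        by (simp flip: exp_of_nat_mult)
      thus ?thesis
        using lim[of k] False by (simp add: \<nu>_def N_def int[OF \<mu>] int[OF M])
    qed
  qed
  show ?thesis
  proof (rule integral_bdd_continuous_conv_imp_weak_conv[OF \<mu> M])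
    fix f :: "real \<Rightarrow> real" assume f: "\<And>x. isCont f x" "\<And>x. \<bar>f x\<bar> \<le> 1"
    have [measurable]: "f \<in> borel_measurable borel"
      using f(1) by (intro borel_measurable_continuous_onI continuous_at_imp_continuous_on) auto
    define g where "g = (\<lambda>y::real. if y > 0 then f (- ln y) else 0)"
    have [measurable]: "g \<in> borel_measurable borel" unfolding g_def by measurable
    have "isCont g y" if "y \<noteq> 0" for y
    proof (cases "y > 0")
      case True
      have "isCont (\<lambda>y. - ln y) y"
        using True by (intro continuous_intros) auto
      hence "isCont (\<lambda>y. f (- ln y)) y"
        using f(1) by (rule isCont_o2)
      moreover have "eventually (\<lambda>z. g z = f (- ln z)) (nhds y)"
        using eventually_nhds_in_open[of "{0<..}" y] True
        by (auto simp: g_def elim!: eventually_mono)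
      ultimately show ?thesis using isCont_cong[of g "\<lambda>z. f (- ln z)" y] by simp
    next
      case False
      have "eventually (\<lambda>z. g z = 0) (nhds y)"
        using eventually_nhds_in_open[of "{..<0}" y] False that
        by (auto simp: g_def elim!: eventually_mono)
      thus ?thesis using isCont_cong[of g "\<lambda>_. 0" y] by simp
    qed
    hence sub: "{y. \<not> isCont g y} \<subseteq> {0}" by auto
    have "emeasure N {0} = 0"
    proof -
      interpret M: real_distribution M by (rule M)
      show ?thesis unfolding N_def by (subst emeasure_distr) (auto simp: vimage_def)
    qed
    hence null: "emeasure N {y. \<not> isCont g y} = 0"
      using sub by (metis emeasure_empty subset_singletonD)
    have "(\<lambda>n. LINT x|\<nu> n. g x) \<longlonglongrightarrow> (LINT x|N. g x)"
      by (rule weak_conv_imp_bdd_ae_continuous_conv[OF \<nu> N wc null, of 1])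
         (use f(2) in \<open>auto simp: g_def\<close>)
    thus "(\<lambda>n. LINT x|\<mu> n. f x) \<longlonglongrightarrow> (LINT x|M. f x)"
      by (simp add: \<nu>_def N_def int[OF \<mu>] int[OF M] g_def)
  qed
qed

text \<open>
  Mass to the left of \<open>- c\<close> would make the Laplace transform at \<open>k\<close> grow at least like \<open>exp (k * c)\<close>.
\<close>

lemma (in real_distribution) AE_nonneg_if_Laplace_le_1:
  assumes "\<And>k. k \<ge> 1 \<Longrightarrow> integrable M (\<lambda>x. exp (- real k * x))"
    and "\<And>k. k \<ge> 1 \<Longrightarrow> expectation (\<lambda>x. exp (- real k * x)) \<le> 1"
  shows "AE x in M. x \<ge> 0"
proof -
  have "AE x in M. x > - c" if c: "c > 0" for c
  proof -
    have le: "prob {..-c} \<le> exp (- c) ^ k" if k: "k \<ge> 1" for k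
    proof -
      have "prob {..-c} = expectation (indicator {..-c})" by simp
      also have "\<dots> \<le> expectation (\<lambda>x. exp (- c) ^ k * exp (- real k * x))"
      proof (intro integral_mono)
        show "integrable M (indicator {..-c} :: real \<Rightarrow> real)"
          by (intro integrable_const_bound[where B = 1]) auto
        fix x :: real
        have "exp (- c) ^ k * exp (- real k * x) = exp (real k * (- c - x))"
          by (simp add: algebra_simps flip: exp_of_nat_mult exp_add)
        thus "indicator {..-c} x \<le> exp (- c) ^ k * exp (- real k * x)"
          by (auto simp: indicator_def)
      qed (use assms(1)[OF k] in auto)
      also have "\<dots> = exp (- c) ^ k * expectation (\<lambda>x. exp (- real k * x))" by simp
      also have "\<dots> \<le> exp (- c) ^ k * 1" using assms(2)[OF k] by (intro mult_left_mono) auto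
      finally show ?thesis by simp
    qed
    have "(\<lambda>k. exp (- c) ^ k) \<longlonglongrightarrow> 0" using c by (intro LIMSEQ_power_zero) auto
    hence "prob {..-c} \<le> 0"
      by (rule LIMSEQ_le_const) (use le in blast)
    hence "prob {..-c} = 0" by (simp add: measure_le_0_iff)
    hence "AE x in M. x \<notin> {..-c}"
      by (intro AE_not_in) (simp add: null_sets_def emeasure_eq_measure)
    thus ?thesis by (auto elim!: eventually_mono)
  qed
  hence "AE x in M. \<forall>n. x > - inverse (real (Suc n))" by (simp add: AE_all_countable)
  thus ?thesis
  proof (rule eventually_mono)
    fix x :: real assume x: "\<forall>n. x > - inverse (real (Suc n))"
    show "x \<ge> 0"
    proof (rule ccontr)
      assume "\<not> x \<ge> 0"
      then obtain n where "inverse (real (Suc n)) < - x" using reals_Archimedean[of "- x"] by auto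
      thus False using x[rule_format, of n] by linarith
    qed
  qed
qed

text \<open>
  Truncating \<open>x\<close> at height \<open>R\<close> turns \<open>x ^ m\<close> into a bounded continuous function and costs at most
  \<open>x ^ Suc m / R\<close>, so the uniform bound on the moments of order \<open>Suc m\<close> makes the error uniformly small.
\<close>

lemma moments_tendsto_if_weak_conv_m:
  fixes \<mu> :: "nat \<Rightarrow> real measure"
  assumes \<mu>: "\<And>n. real_distribution (\<mu> n)" and M: "real_distribution M"
    and \<mu>_nonneg: "\<And>n. AE x in \<mu> n. x \<ge> 0" and M_nonneg: "AE x in M. x \<ge> 0"
    and wc: "weak_conv_m \<mu> M"
    and \<mu>_int: "\<And>n m. integrable (\<mu> n) (\<lambda>x. x ^ m)"
    and bound: "\<And>n m. (LINT x|\<mu> n. x ^ m) \<le> K m"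
  shows "integrable M (\<lambda>x. x ^ m)" and "(\<lambda>n. LINT x|\<mu> n. x ^ m) \<longlonglongrightarrow> (LINT x|M. x ^ m)"
proof -
  interpret M: real_distribution M by (rule M)
  define g where "g = (\<lambda>m R (x::real). (min \<bar>x\<bar> R) ^ m)"
  have g_meas [measurable]: "g m R \<in> borel_measurable borel" for m R unfolding g_def by measurable
  have g_abs: "\<bar>g m R x\<bar> \<le> R ^ m" if "R \<ge> 0" for m R x
    using that by (auto simp: g_def power_abs intro!: power_mono)
  have g_int: "integrable L (g m R)" if "R \<ge> 0" "real_distribution L" for m R and L :: "real measure"
  proof -
    interpret L: real_distribution L by (rule that)
    show ?thesis using g_abs[OF that(1)] by (intro L.integrable_const_bound[where B = "R ^ m"]) auto
  qed
  have g_lim: "(\<lambda>n. LINT x|\<mu> n. g m R x) \<longlonglongrightarrow> (LINT x|M. g m R x)" if "R \<ge> 0" for m R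
    using g_abs[OF that]
    by (intro weak_conv_imp_integral_bdd_continuous_conv[OF \<mu> M wc, of _ "R ^ m"])
       (auto simp: g_def intro!: continuous_intros)
  have g_le: "g m R x \<le> x ^ m" if "R \<ge> 0" "x \<ge> 0" for m R x
    using that by (auto simp: g_def intro!: power_mono)
  have g_diff: "\<bar>x ^ m - g m R x\<bar> \<le> x ^ Suc m / R" if "R > 0" "x \<ge> 0" for m R x
  proof (cases "x \<le> R")
    case True
    thus ?thesis using that by (simp add: g_def)
  next
    case False
    have "\<bar>x ^ m - g m R x\<bar> \<le> x ^ m" using that g_le[of R x m] by (simp add: g_def)
    also have "\<dots> \<le> x ^ m * (x / R)" using that False mult_left_mono[of 1 "x / R" "x ^ m"] by simp
    finally show ?thesis by (simp add: mult.commute)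
  qed
  have M_bound: "(LINT x|M. g m R x) \<le> K m" if "R \<ge> 0" for m R
  proof (rule LIMSEQ_le_const2[OF g_lim[OF that]], intro exI allI impI)
    fix n
    have "(LINT x|\<mu> n. g m R x) \<le> (LINT x|\<mu> n. x ^ m)"
      using g_le[OF that] \<mu>_nonneg[of n]
      by (intro integral_mono_AE g_int \<mu>_int \<mu> that) (auto elim!: eventually_mono)
    thus "(LINT x|\<mu> n. g m R x) \<le> K m" using bound[of n m] by linarith
  qed
  have M_int: "integrable M (\<lambda>x. x ^ m)" for m
  proof -
    let ?I = "\<lambda>r. LINT x|M. g m (real r) x"
    have "incseq ?I"
      by (intro incseq_SucI integral_mono g_int M) (auto simp: g_def intro!: power_mono)
    hence I_lim: "?I \<longlonglongrightarrow> (SUP r. ?I r)"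
      using M_bound by (intro LIMSEQ_incseq_SUP bdd_aboveI2[where M = "K m"]) auto
    have pointwise: "AE x in M. (\<lambda>r. g m (real r) x) \<longlonglongrightarrow> x ^ m"
      using M_nonneg
    proof (rule eventually_mono)
      fix x :: real assume "x \<ge> 0"
      have "eventually (\<lambda>r. x \<le> real r) sequentially"
        using eventually_ge_at_top[of "nat \<lceil>x\<rceil>"] by eventually_elim (simp add: nat_ceiling_le_eq)
      hence "eventually (\<lambda>r. g m (real r) x = x ^ m) sequentially"
        by eventually_elim (use \<open>x \<ge> 0\<close> in \<open>simp add: g_def\<close>)
      thus "(\<lambda>r. g m (real r) x) \<longlonglongrightarrow> x ^ m" by (rule tendsto_eventually)
    qed
    have "incseq (\<lambda>r. g m (real r) x)" for x
      by (intro incseq_SucI) (auto simp: g_def intro!: power_mono)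
    hence "AE x in M. incseq (\<lambda>r. g m (real r) x)" by (rule AE_I2)
    thus ?thesis
      by (rule integrable_monotone_convergence[OF g_int[OF of_nat_0_le_iff M] _ pointwise I_lim]) simp
  qed
  show "integrable M (\<lambda>x. x ^ m)" by (rule M_int)
  show "(\<lambda>n. LINT x|\<mu> n. x ^ m) \<longlonglongrightarrow> (LINT x|M. x ^ m)"
  proof (rule LIMSEQ_I)
    fix e :: real assume "e > 0"
    define D where "D = max (K (Suc m)) (LINT x|M. x ^ Suc m)"
    define R where "R = max 1 (3 * D / e + 1)"
    have R: "R > 0" "D / R < e / 3"
    proof -
      show "R > 0" by (simp add: R_def)
      have "3 * D / e < R" by (simp add: R_def)
      thus "D / R < e / 3" using \<open>R > 0\<close> \<open>e > 0\<close> by (simp add: field_simps)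
    qed
    have close: "\<bar>(LINT x|L. x ^ m) - (LINT x|L. g m R x)\<bar> < e / 3"
      if L: "real_distribution L" "AE x in L. x \<ge> 0" "\<And>m. integrable L (\<lambda>x. x ^ m)"
        "(LINT x|L. x ^ Suc m) \<le> D" for L
    proof -
      have int: "integrable L (g m R)" using R L by (intro g_int) auto
      have "\<bar>(LINT x|L. x ^ m) - (LINT x|L. g m R x)\<bar> = \<bar>LINT x|L. x ^ m - g m R x\<bar>"
        using int L by simp
      also have "\<dots> \<le> (LINT x|L. \<bar>x ^ m - g m R x\<bar>)" by (rule integral_abs_bound)
      also have "\<dots> \<le> (LINT x|L. x ^ Suc m / R)"
        using L(2) g_diff[OF R(1)] int L(3)[of m] L(3)[of "Suc m"]
        by (intro integral_mono_AE) (auto elim!: eventually_mono)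
      also have "\<dots> \<le> D / R" using L(4) R by (simp add: divide_right_mono)
      finally show ?thesis using R by linarith
    qed
    obtain n0 where n0: "\<And>n. n \<ge> n0 \<Longrightarrow> \<bar>(LINT x|\<mu> n. g m R x) - (LINT x|M. g m R x)\<bar> < e / 3"
      using LIMSEQ_D[OF g_lim[of R m], of "e / 3"] R(1) \<open>e > 0\<close> by (auto simp: less_imp_le)
    have "norm ((LINT x|\<mu> n. x ^ m) - (LINT x|M. x ^ m)) < e" if "n \<ge> n0" for n
    proof -
      have "\<bar>(LINT x|\<mu> n. x ^ m) - (LINT x|\<mu> n. g m R x)\<bar> < e / 3"
        using bound[of n "Suc m"] by (intro close \<mu> \<mu>_nonneg \<mu>_int) (auto simp: D_def)
      moreover have "\<bar>(LINT x|M. x ^ m) - (LINT x|M. g m R x)\<bar> < e / 3"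
        by (intro close M M_nonneg M_int) (auto simp: D_def)
      ultimately show ?thesis using n0[OF that] unfolding real_norm_def by linarith
    qed
    thus "\<exists>n0. \<forall>n\<ge>n0. norm ((LINT x|\<mu> n. x ^ m) - (LINT x|M. x ^ m)) < e" by blast
  qed
qed

lemma power_le_exp:
  assumes "x \<ge> (0::real)"
  shows "x ^ m \<le> fact m * exp x"
proof -
  have "x ^ m / fact m \<le> exp x"
    using sum_le_suminf[OF summable_exp_generic[of x], of "{m}"] assms
    by (simp add: exp_def scaleR_conv_of_real field_simps)
  thus ?thesis by (simp add: field_simps)
qed

section \<open>The number of trees in a random forest\<close>

lemma set_pmf_random_forest: "set_pmf (random_forest n) = unlabeled_forests n"
  by (simp add: random_forest_def set_pmf_of_set finite_unlabeled_forests unlabeled_forests_nonempty)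

lemma integrable_random_forest: "integrable (measure_pmf (random_forest n)) (f :: _ \<Rightarrow> real)"
  by (rule integrable_measure_pmf_finite) (simp add: set_pmf_random_forest finite_unlabeled_forests)

lemma expectation_power_num_trees:
  "measure_pmf.expectation (random_forest n) (\<lambda>C. y ^ num_trees n C) = forest_gf y n / forest_gf 1 n"
  by (simp add: random_forest_def forest_gf_def integral_pmf_of_set
      finite_unlabeled_forests unlabeled_forests_nonempty)

definition extra_trees_distr :: "nat \<Rightarrow> real measure" where
  "extra_trees_distr n = distr (measure_pmf (random_forest n)) borel (\<lambda>C. real (num_trees n C) - 1)"

lemma integral_extra_trees_distr:
  "f \<in> borel_measurable borel \<Longrightarrow> (LINT x|extra_trees_distr n. f x) =
     measure_pmf.expectation (random_forest n) (\<lambda>C. f (real (num_trees n C) - 1))"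
  for f :: "real \<Rightarrow> real"
  unfolding extra_trees_distr_def by (rule integral_distr) auto

lemma integrable_extra_trees_distr:
  "f \<in> borel_measurable borel \<Longrightarrow> integrable (extra_trees_distr n) f" for f :: "real \<Rightarrow> real"
  unfolding extra_trees_distr_def by (subst integrable_distr_eq) (auto intro: integrable_random_forest)

lemma real_distribution_extra_trees_distr: "real_distribution (extra_trees_distr n)"
  unfolding extra_trees_distr_def by (rule prob_space.real_distribution_distr[OF prob_space_measure_pmf]) simp

lemma extra_trees_distr_nonneg:
  assumes "n \<ge> 1"
  shows "AE x in extra_trees_distr n. x \<ge> 0"
  unfolding extra_trees_distr_def
  by (subst AE_distr_iff)
     (use num_trees_pos[OF _ assms] in \<open>auto simp: AE_measure_pmf_iff set_pmf_random_forest\<close>)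

context otter_asymptotics
begin

text \<open>
  The probability generating function of the number of trees stays bounded even at the point
  \<open>z = \<alpha> powr (-1/4) > 1\<close>, and such an exponential moment dominates all powers.
\<close>

lemma extra_trees_moments_bounded:
  obtains K where "\<And>n m. n \<ge> 1 \<Longrightarrow> (LINT x|extra_trees_distr n. x ^ m) \<le> K m"
proof -
  define z where "z = 1 / root 4 \<alpha>"
  have z: "z > 1" "z ^ 4 * \<alpha> = 1"
    using \<alpha>_pos \<alpha>_less_1 by (simp_all add: z_def power_divide)
  define s where "s = ln z"
  have s: "s > 0" using z(1) by (simp add: s_def)
  have "(\<lambda>n. forest_gf z n / forest_gf 1 n) \<longlonglongrightarrow>
      z * exp ((\<Sum>m. power_sum_coeff \<alpha> z m) - (\<Sum>m. power_sum_coeff \<alpha> 1 m))"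
    using z by (intro forest_gf_ratio_tendsto) auto
  hence "Bseq (\<lambda>n. forest_gf z n / forest_gf 1 n)" by (intro convergent_imp_Bseq convergentI)
  then obtain B where B: "\<And>n. norm (forest_gf z n / forest_gf 1 n) \<le> B" unfolding Bseq_def by blast
  have "(LINT x|extra_trees_distr n. x ^ m) \<le> fact m / s ^ m * B" if n: "n \<ge> 1" for n m
  proof -
    have "(LINT x|extra_trees_distr n. x ^ m) =
        measure_pmf.expectation (random_forest n) (\<lambda>C. (real (num_trees n C) - 1) ^ m)"
      by (simp add: integral_extra_trees_distr)
    also have "\<dots> \<le> measure_pmf.expectation (random_forest n) (\<lambda>C. fact m / s ^ m * z ^ num_trees n C)"
    proof (intro integral_mono_AE integrable_random_forest)
      have "(real (num_trees n C) - 1) ^ m \<le> fact m / s ^ m * z ^ num_trees n C"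
        if C: "C \<in> unlabeled_forests n" for C
      proof -
        let ?x = "real (num_trees n C) - 1"
        have "?x \<ge> 0" using num_trees_pos[OF C n] by simp
        hence "(s * ?x) ^ m \<le> fact m * exp (s * ?x)" using s by (intro power_le_exp) auto
        also have "\<dots> \<le> fact m * exp (real (num_trees n C) * s)"
          using s by (simp add: algebra_simps)
        also have "exp (real (num_trees n C) * s) = z ^ num_trees n C"
          using z(1) by (simp add: s_def exp_of_nat_mult)
        finally have "s ^ m * ?x ^ m \<le> fact m * z ^ num_trees n C"
          by (simp only: power_mult_distrib)
        thus ?thesis using s by (simp add: field_simps)
      qed
      thus "AE C in measure_pmf (random_forest n).
          (real (num_trees n C) - 1) ^ m \<le> fact m / s ^ m * z ^ num_trees n C"
        by (simp add: AE_measure_pmf_iff set_pmf_random_forest)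
    qed
    also have "\<dots> = fact m / s ^ m * (forest_gf z n / forest_gf 1 n)"
      by (simp add: expectation_power_num_trees)
    also have "\<dots> \<le> fact m / s ^ m * B"
      using abs_le_D1[OF B[of n, unfolded real_norm_def]] s by (intro mult_left_mono) auto
    finally show ?thesis .
  qed
  thus ?thesis by (rule that[of "\<lambda>m. fact m / s ^ m * B"])
qed

text \<open>
  With \<open>z = exp (- \<phi>)\<close> the factor \<open>z\<close> in the limit of the probability generating function belongs to the
  single giant tree; it cancels because that tree is subtracted from the number of trees.
\<close>

lemma extra_trees_Laplace_tendsto:
  assumes "\<phi> > 0"
  shows "(\<lambda>n. LINT x|extra_trees_distr n. exp (- \<phi> * x)) \<longlonglongrightarrow>
           exp (- (\<Sum>k. tree_gf (\<alpha> ^ Suc k) / real (Suc k) * (1 - exp (- \<phi> * real (Suc k)))))"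
proof -
  define z where "z = exp (- \<phi>)"
  have z: "0 < z" "z < 1" using assms by (simp_all add: z_def)
  have z_pow: "exp (- \<phi> * real k) = z ^ k" for k
    by (simp add: z_def mult.commute flip: exp_of_nat_mult)
  have "(LINT x|extra_trees_distr n. exp (- \<phi> * x)) = exp \<phi> * (forest_gf z n / forest_gf 1 n)" for n
  proof -
    have "exp (- \<phi> * (real k - 1)) = exp \<phi> * z ^ k" for k
      unfolding z_pow[symmetric] by (simp add: algebra_simps flip: exp_add)
    hence "(LINT x|extra_trees_distr n. exp (- \<phi> * x)) =
        measure_pmf.expectation (random_forest n) (\<lambda>C. exp \<phi> * z ^ num_trees n C)"
      by (subst integral_extra_trees_distr) auto
    thus ?thesis by (simp add: expectation_power_num_trees)
  qed
  moreover have "(\<lambda>n. exp \<phi> * (forest_gf z n / forest_gf 1 n)) \<longlonglongrightarrow>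
      exp \<phi> * (z * exp ((\<Sum>m. power_sum_coeff \<alpha> z m) - (\<Sum>m. power_sum_coeff \<alpha> 1 m)))"
    using z \<alpha>_pos \<alpha>_less_1 by (intro tendsto_mult tendsto_const forest_gf_ratio_tendsto mult_le_one power_le_one) auto
  moreover have "(\<Sum>m. power_sum_coeff \<alpha> z m) - (\<Sum>m. power_sum_coeff \<alpha> 1 m) =
      - (\<Sum>k. tree_gf (\<alpha> ^ Suc k) / real (Suc k) * (1 - exp (- \<phi> * real (Suc k))))"
  proof -
    have "(\<Sum>k. tree_gf (\<alpha> ^ Suc k) / real (Suc k) * 1 ^ Suc k) - (\<Sum>k. tree_gf (\<alpha> ^ Suc k) / real (Suc k) * z ^ Suc k)
        = (\<Sum>k. tree_gf (\<alpha> ^ Suc k) / real (Suc k) * 1 ^ Suc k - tree_gf (\<alpha> ^ Suc k) / real (Suc k) * z ^ Suc k)"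
      using z by (intro suminf_diff power_sum_coeff_sums(2)) auto
    also have "\<dots> = (\<Sum>k. tree_gf (\<alpha> ^ Suc k) / real (Suc k) * (1 - exp (- \<phi> * real (Suc k))))"
      unfolding z_pow by (simp only: power_one right_diff_distrib)
    finally show ?thesis
      using z power_sum_coeff_sums(1)[of z] power_sum_coeff_sums(1)[of 1] by simp
  qed
  moreover have "exp \<phi> * (z * y) = y" for y by (simp add: z_def exp_minus)
  ultimately show ?thesis by simp
qed

end

theorem theorem1:
  fixes \<alpha> \<beta> :: real and M :: "'b measure" and P :: "'b \<Rightarrow> real"
  assumes "\<alpha> > 0" and "\<beta> > 0"
    and otter: "(\<lambda>n. \<alpha> ^ n * real n powr (5/2) * real (tree_count n)) \<longlonglongrightarrow> \<beta>"
    and "prob_space M" and "P \<in> borel_measurable M"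
    and "compound_poisson M P (discrete_measure (\<lambda>k. tree_gf (\<alpha> ^ k) / real k))"
  shows "weak_conv_m
           (\<lambda>n. distr (measure_pmf (random_forest n)) borel (\<lambda>C. real (num_trees n C) - 1))
           (distr M borel P)
       \<and> (\<forall>m\<ge>(1::nat). integrable M (\<lambda>\<omega>. P \<omega> ^ m) \<and>
             (\<lambda>n. measure_pmf.expectation (random_forest n) (\<lambda>C. (real (num_trees n C) - 1) ^ m))
               \<longlonglongrightarrow> (LINT \<omega>|M. P \<omega> ^ m))"
proof -
  interpret otter_asymptotics \<alpha> \<beta> by standard (fact assms)+
  interpret M: prob_space M by (fact assms)
  note [measurable] = \<open>P \<in> borel_measurable M\<close>
  define L where "L = distr M borel P"
  interpret L: real_distribution L
    unfolding L_def by (rule M.real_distribution_distr) simp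
  define \<xi> where "\<xi> = (\<lambda>k. tree_gf (\<alpha> ^ k) / real k)"
  have \<xi>_nonneg: "\<xi> k \<ge> 0" for k
    using tree_gf_has_sum(3)[of k] by (cases "k = 0") (auto simp: \<xi>_def)
  have L_Laplace: "(LINT x|L. exp (- \<phi> * x)) = exp (- (\<Sum>k. \<xi> (Suc k) * (1 - exp (- \<phi> * real (Suc k)))))"
    and sum_nonneg: "(\<Sum>k. \<xi> (Suc k) * (1 - exp (- \<phi> * real (Suc k)))) \<ge> 0" if "\<phi> > 0" for \<phi>
  proof -
    let ?f = "\<lambda>x. 1 - exp (- \<phi> * x)"
    have cp: "set_integrable (discrete_measure \<xi>) {0<..} ?f"
      "(LINT \<omega>|M. exp (- \<phi> * P \<omega>)) = exp (- (LINT x:{0<..}|discrete_measure \<xi>. ?f x))"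
      using \<open>compound_poisson M P _\<close> that unfolding compound_poisson_def \<xi>_def by blast+
    have f: "?f \<in> borel_measurable borel" by measurable
    have abs_summable: "summable (\<lambda>k. \<bar>\<xi> (Suc k) * ?f (real (Suc k))\<bar>)"
      using cp(1) by (simp only: set_integrable_discrete_measure[OF \<xi>_nonneg f])
    have "(LINT x|L. exp (- \<phi> * x)) = (LINT \<omega>|M. exp (- \<phi> * P \<omega>))"
      unfolding L_def by (rule integral_distr) auto
    thus "(LINT x|L. exp (- \<phi> * x)) = exp (- (\<Sum>k. \<xi> (Suc k) * ?f (real (Suc k))))"
      using cp(2) LINT_discrete_measure[OF \<xi>_nonneg f abs_summable] by simp
    show "(\<Sum>k. \<xi> (Suc k) * ?f (real (Suc k))) \<ge> 0"
      using that by (intro suminf_nonneg summable_rabs_cancel[OF abs_summable] mult_nonneg_nonneg \<xi>_nonneg) simp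
  qed
  have L_nonneg: "AE x in L. x \<ge> 0"
  proof (rule L.AE_nonneg_if_Laplace_le_1)
    fix k :: nat assume "k \<ge> 1"
    hence k: "real k > 0" by simp
    show "integrable L (\<lambda>x. exp (- real k * x))"
      using not_integrable_integral_eq[of L "\<lambda>x. exp (- real k * x)"] L_Laplace[OF k] by auto
    show "L.expectation (\<lambda>x. exp (- real k * x)) \<le> 1"
      unfolding L_Laplace[OF k] using sum_nonneg[OF k] by simp
  qed
  note L = L.real_distribution_axioms
  \<comment> \<open>The empty forest has no giant tree to subtract, so the sequences start at one vertex.\<close>
  have wc: "weak_conv_m (\<lambda>n. extra_trees_distr (Suc n)) L"
  proof (rule weak_conv_m_if_Laplace[OF real_distribution_extra_trees_distr L extra_trees_distr_nonneg L_nonneg])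
    fix k :: nat assume "k \<ge> 1"
    hence k: "real k > 0" by simp
    show "(\<lambda>n. LINT x|extra_trees_distr (Suc n). exp (- real k * x)) \<longlonglongrightarrow> (LINT x|L. exp (- real k * x))"
      using extra_trees_Laplace_tendsto[OF k] unfolding L_Laplace[OF k] \<xi>_def by (rule LIMSEQ_Suc)
  qed simp
  obtain K where K: "\<And>n m. n \<ge> 1 \<Longrightarrow> (LINT x|extra_trees_distr n. x ^ m) \<le> K m"
    using extra_trees_moments_bounded by blast
  have moments: "integrable L (\<lambda>x. x ^ m)"
      "(\<lambda>n. LINT x|extra_trees_distr (Suc n). x ^ m) \<longlonglongrightarrow> (LINT x|L. x ^ m)" for m
    by (rule moments_tendsto_if_weak_conv_m[OF real_distribution_extra_trees_distr L
          extra_trees_distr_nonneg L_nonneg wc, of K]; simp add: K integrable_extra_trees_distr)+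
  have "weak_conv_m extra_trees_distr L"
    using wc unfolding weak_conv_m_def weak_conv_def by (auto intro: LIMSEQ_imp_Suc)
  moreover have "integrable M (\<lambda>\<omega>. P \<omega> ^ m)" for m
    using moments(1)[of m] unfolding L_def by (simp add: integrable_distr_eq)
  moreover have "(\<lambda>n. measure_pmf.expectation (random_forest n) (\<lambda>C. (real (num_trees n C) - 1) ^ m))
      \<longlonglongrightarrow> (LINT \<omega>|M. P \<omega> ^ m)" for m
  proof -
    have "(\<lambda>n. LINT x|extra_trees_distr n. x ^ m) \<longlonglongrightarrow> (LINT x|L. x ^ m)"
      using moments(2)[of m] by (rule LIMSEQ_imp_Suc)
    moreover have "(LINT x|L. x ^ m) = (LINT \<omega>|M. P \<omega> ^ m)"
      unfolding L_def by (rule integral_distr) auto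
    ultimately show ?thesis by (simp add: integral_extra_trees_distr)
  qed
  ultimately show ?thesis unfolding extra_trees_distr_def L_def by blast
qed

end
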